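(* Let $\boldsymbol{\omega}=(\omega_x,\omega_y)^T$ be a fixed transport velocity and consider the SD-RT(1) scheme (defined in the context) for the transport equation $\partial v/\partial t+\boldsymbol{\omega}\cdot\nabla v=0$ on the right-triangular meshes with steps $h$, $1/h\in\mathbb{N}$. If $\omega_x>0$ and $\omega_y>0$, then the optimal order of accuracy of the scheme is $2$. If $\omega_x>\omega_y=0$, then the optimal order of accuracy of the scheme is $1$.
   Context: **Problem.** The Cauchy problem is $\frac{\partial v}{\partial t}+\boldsymbol{\omega}\cdot\nabla v=0$ on $\mathbb{R}^2$, $v(0,\boldsymbol r)=v_0(\boldsymbol r)$, with constant $\boldsymbol\omega=(\omega_x,\omega_y)^T$ and $v_0$ 1-periodic, i.e. periodic with periodic cell $(0,1)^2$. Its solution is $v(t,\boldsymbol r)=v_0(\boldsymbol r-\boldsymbol\omega t)$. It is assumed throughout that $\omega_x,\omega_y\ge 0$, $\omega_x+\omega_y>0$. **Mesh.** For $1/h\in\mathbb N$ the mesh nodes are $(mh,nh)^T$, $m,n\in\mathbb Z$, and each node $(mh,nh)^T$ is connected by edges to $((m+1)h,nh)^T$, $(mh,(n+1)h)^T$, $((m+1)h,(n-1)h)^T$. **SD-RT(1).** Let $P_1$ be the space of polynomials of degree at most 1 in two variables and $RT_1=P_1^2+(x,y)^TP_1$. The unknown is a 1-periodic, generally discontinuous, piecewise linear function $u=\{u_e\in P_1\}$ ($e$ runs over the mesh triangles), satisfying $\frac{\partial u_e}{\partial t}+\mathrm{div}\,\boldsymbol f_e[u]=0$ on each triangle $e$.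 Here $\boldsymbol f_e[u]\in RT_1$ is determined by: (i) $\boldsymbol f_e[u]=\boldsymbol\omega u$ at the mass center of $e$; (ii) at two fixed distinct points on each edge of $e$ (e.g. Gauss–Legendre knots), $\boldsymbol f_e[u]\cdot\boldsymbol n$ equals $\boldsymbol\omega\cdot\boldsymbol n$ times the upwind one-sided limit of $u$, where $\boldsymbol n$ is the unit normal to the edge. **Matrix form.** The scheme is equivalently written as follows. Put $\boldsymbol a_1=(0,0)^T$, $\boldsymbol a_2=\boldsymbol a_6=(1,0)^T$, $\boldsymbol a_3=\boldsymbol a_4=(0,1)^T$, $\boldsymbol a_5=(1,1)^T$. In the block $[\eta_xh,(\eta_x+1)h]\times[\eta_yh,(\eta_y+1)h]$, $\boldsymbol\eta=(\eta_x,\eta_y)\in\mathbb Z^2$, components 1,2,3 of $u_{\boldsymbol\eta}\in\mathbb C^6$ are the vertex values of $u$ in the triangle with vertices $(\boldsymbol\eta+\boldsymbol a_\xi)h$, $\xi=1,2,3$, and components 4,5,6 are those in the triangle with vertices $(\boldsymbol\eta+\boldsymbol a_\xi)h$, $\xi=4,5,6$. The scheme is $$\frac{du_{\boldsymbol\eta}}{dt}(t)+\frac1h\sum_{\boldsymbol\zeta\in\mathcal S}L_{\boldsymbol\zeta}u_{\boldsymbol\eta+\boldsymbol\zeta}(t)=0,\quad \boldsymbol\eta\in\mathbb Z^2,\qquad \mathcal S=\{(0,0),(-1,0),(0,-1)\},$$ with $L_{\boldsymbol\zeta}=\omega_xL^x_{\boldsymbol\zeta}+\omega_yL^y_{\boldsymbol\zeta}$,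 $L^x_{(0,-1)}=0$, $L^y_{(-1,0)}=0$, $$L^x_{(0,0)}=\begin{pmatrix}3&1&1&0&0&0\\-3&1&-2&0&0&0\\0&1&4&0&0&0\\0&-1&-4&3&1&1\\0&2&2&-3&1&-2\\0&-4&-1&0&1&4\end{pmatrix},\quad L^x_{(-1,0)}=\begin{pmatrix}0&0&0&0&-1&-4\\0&0&0&0&2&2\\0&0&0&0&-4&-1\\0&0&0&0&0&0\\0&0&0&0&0&0\\0&0&0&0&0&0\end{pmatrix},$$ $$L^y_{(0,0)}=\begin{pmatrix}3&1&1&0&0&0\\0&4&1&0&0&0\\-3&-2&1&0&0&0\\0&-1&-4&4&1&0\\0&2&2&-2&1&-3\\0&-4&-1&1&1&3\end{pmatrix},\quad L^y_{(0,-1)}=\begin{pmatrix}0&0&0&-4&-1&0\\0&0&0&-1&-4&0\\0&0&0&2&2&0\\0&0&0&0&0&0\\0&0&0&0&0&0\\0&0&0&0&0&0\end{pmatrix}.$$ **Initial data, norm, error.** The Lagrangian mapping is $(\Pi_hv)_{\boldsymbol\eta,\xi}=v((\boldsymbol\eta+\boldsymbol a_\xi)h)$, $\xi=1,\dots,6$. The initial data are $u(0)=\Pi_hv_0$. The norm of a 1-periodic mesh function (i.e. $u_{\boldsymbol\eta}$ is $1/h$-periodic in $\eta_x$ and $\eta_y$) is $\|f\|^2=\sum_{\boldsymbol\eta\in\{1,\dots,1/h\}^2}h^2\|f_{\boldsymbol\eta}\|^2$, with the Euclidean norm on $\mathbb C^6$. The solution error is $\varepsilon_h(t,v_0)=u(t)-\Pi_hv(t,\cdot)$.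 **Order.** For an integer $q\ge0$ the scheme has order $q$ if for each 1-periodic $v_0\in C^{q+1}(\mathbb R^2)$ there are constants $c_1,c_2$ depending on $v_0$ (not on $h$ or $t$) such that $\|\varepsilon_h(t,v_0)\|\le(c_1+c_2t)h^q$ for all $t\ge0$ and all $h$ with $1/h\in\mathbb N$. The optimal order of accuracy is the maximal $q$ for which the scheme has order $q$. *)

theory Defs
  imports "HOL-Analysis.Analysis"
begin

text \<open>
  The plane is \<^typ>\<open>real \<times> real\<close>, mesh blocks are indexed by \<^typ>\<open>int \<times> int\<close>, and the six
  degrees of freedom of a block (two triangles with three vertices each) form a
  \<^typ>\<open>complex^6\<close>, whose norm is the Euclidean one.  The mesh step is \<open>h = 1 / N\<close> with
  \<open>N > 0\<close> a natural number.
\<close>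

lemma vector_6 [simp]:
  "(vector [a,b,c,d,e,f] :: ('a::zero)^6) $ 1 = a"
  "(vector [a,b,c,d,e,f] :: ('a::zero)^6) $ 2 = b"
  "(vector [a,b,c,d,e,f] :: ('a::zero)^6) $ 3 = c"
  "(vector [a,b,c,d,e,f] :: ('a::zero)^6) $ 4 = d"
  "(vector [a,b,c,d,e,f] :: ('a::zero)^6) $ 5 = e"
  "(vector [a,b,c,d,e,f] :: ('a::zero)^6) $ 6 = f"
  unfolding vector_def by simp_all


text \<open>\<open>C_k k f\<close>: \<open>f\<close> is of class \<open>C\<^sup>k\<close> on the whole space.\<close>

primrec C_k :: "nat \<Rightarrow> ('a::real_normed_vector \<Rightarrow> 'b::real_normed_vector) \<Rightarrow> bool" where
  "C_k 0 f \<longleftrightarrow> continuous_on UNIV f"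
| "C_k (Suc k) f \<longleftrightarrow>
     (\<forall>x. f differentiable (at x)) \<and> (\<forall>v. C_k k (\<lambda>x. frechet_derivative f (at x) v))"

definition periodic1 :: "(real \<times> real \<Rightarrow> complex) \<Rightarrow> bool" where
  "periodic1 v \<longleftrightarrow> (\<forall>x y. v (x + 1, y) = v (x, y) \<and> v (x, y + 1) = v (x, y))"

text \<open>The solution at time \<open>t\<close> of \<open>v\<^sub>t + \<omega> \<cdot> \<nabla>v = 0\<close> with initial data \<open>v0\<close>.\<close>

definition exact_solution ::
    "real \<times> real \<Rightarrow> (real \<times> real \<Rightarrow> complex) \<Rightarrow> real \<Rightarrow> real \<times> real \<Rightarrow> complex" where
  "exact_solution \<omega> v0 t r = v0 (r - t *\<^sub>R \<omega>)"


text \<open>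
  The SD-RT(1) scheme in matrix form.  In block \<open>\<eta>\<close>, components 1, 2, 3 are the vertex values of
  the linear function on the triangle with vertices \<open>(\<eta> + a \<xi>) h\<close>, \<open>\<xi> = 1, 2, 3\<close>, and components
  4, 5, 6 those on the triangle with vertices \<open>(\<eta> + a \<xi>) h\<close>, \<open>\<xi> = 4, 5, 6\<close>.  The entries of the
  matrices come from evaluating, at these vertices, the divergence of the \<open>RT\<^sub>1\<close> flux that equals
  \<open>\<omega> u\<close> at the mass center and has the upwind normal component at two points of every edge, for a
  velocity with nonnegative components.
\<close>

definition sd_vertex :: "6 \<Rightarrow> int \<times> int" where
  "sd_vertex \<xi> = (vector [(0,0), (1,0), (0,1), (0,1), (1,1), (1,0)] :: (int \<times> int)^6) $ \<xi>"

definition sd_stencil :: "(int \<times> int) set" where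
  "sd_stencil = {(0,0), (-1,0), (0,-1)}"

definition sd_Lx :: "int \<times> int \<Rightarrow> complex^6^6" where
  "sd_Lx \<zeta> =
    (if \<zeta> = (0,0) then
       vector [vector [ 3,  1,  1,  0,  0,  0],
               vector [-3,  1, -2,  0,  0,  0],
               vector [ 0,  1,  4,  0,  0,  0],
               vector [ 0, -1, -4,  3,  1,  1],
               vector [ 0,  2,  2, -3,  1, -2],
               vector [ 0, -4, -1,  0,  1,  4]]
     else if \<zeta> = (-1,0) then
       vector [vector [ 0,  0,  0,  0, -1, -4],
               vector [ 0,  0,  0,  0,  2,  2],
               vector [ 0,  0,  0,  0, -4, -1],
               vector [ 0,  0,  0,  0,  0,  0],
               vector [ 0,  0,  0,  0,  0,  0],
               vector [ 0,  0,  0,  0,  0,  0]]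
     else 0)"

definition sd_Ly :: "int \<times> int \<Rightarrow> complex^6^6" where
  "sd_Ly \<zeta> =
    (if \<zeta> = (0,0) then
       vector [vector [ 3,  1,  1,  0,  0,  0],
               vector [ 0,  4,  1,  0,  0,  0],
               vector [-3, -2,  1,  0,  0,  0],
               vector [ 0, -1, -4,  4,  1,  0],
               vector [ 0,  2,  2, -2,  1, -3],
               vector [ 0, -4, -1,  1,  1,  3]]
     else if \<zeta> = (0,-1) then
       vector [vector [ 0,  0,  0, -4, -1,  0],
               vector [ 0,  0,  0, -1, -4,  0],
               vector [ 0,  0,  0,  2,  2,  0],
               vector [ 0,  0,  0,  0,  0,  0],
               vector [ 0,  0,  0,  0,  0,  0],
               vector [ 0,  0,  0,  0,  0,  0]]
     else 0)"

definition sd_L :: "real \<times> real \<Rightarrow> int \<times> int \<Rightarrow> complex^6^6" where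
  "sd_L \<omega> \<zeta> = fst \<omega> *\<^sub>R sd_Lx \<zeta> + snd \<omega> *\<^sub>R sd_Ly \<zeta>"

definition sd_lagrange :: "nat \<Rightarrow> (real \<times> real \<Rightarrow> complex) \<Rightarrow> int \<times> int \<Rightarrow> complex^6" where
  "sd_lagrange N v \<eta> =
     (\<chi> \<xi>. v (of_int (fst (\<eta> + sd_vertex \<xi>)) * (1 / real N),
              of_int (snd (\<eta> + sd_vertex \<xi>)) * (1 / real N)))"

definition mesh_periodic :: "nat \<Rightarrow> (int \<times> int \<Rightarrow> complex^6) \<Rightarrow> bool" where
  "mesh_periodic N f \<longleftrightarrow>
     (\<forall>i j. f (i + int N, j) = f (i, j) \<and> f (i, j + int N) = f (i, j))"

definition mesh_norm :: "nat \<Rightarrow> (int \<times> int \<Rightarrow> complex^6) \<Rightarrow> real" where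
  "mesh_norm N f =
     sqrt (\<Sum>\<eta> \<in> {1..int N} \<times> {1..int N}. (1 / real N)\<^sup>2 * (norm (f \<eta>))\<^sup>2)"

text \<open>
  Spatial periodicity is part of the notion of solution; together with the initial data it
  determines \<open>u\<close> on \<open>t \<ge> 0\<close>.  The factor \<open>N\<close> is \<open>1 / h\<close>.
\<close>

definition sd_solution ::
    "real \<times> real \<Rightarrow> nat \<Rightarrow> (real \<times> real \<Rightarrow> complex) \<Rightarrow> (real \<Rightarrow> int \<times> int \<Rightarrow> complex^6) \<Rightarrow> bool" where
  "sd_solution \<omega> N v0 u \<longleftrightarrow>
     u 0 = sd_lagrange N v0 \<and>
     (\<forall>t\<ge>0. mesh_periodic N (u t)) \<and>
     (\<forall>t\<ge>0. \<forall>\<eta>. ((\<lambda>s. u s \<eta>) has_vector_derivative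
        - (real N *\<^sub>R (\<Sum>\<zeta>\<in>sd_stencil. sd_L \<omega> \<zeta> *v u t (\<eta> + \<zeta>))))
        (at t within {0..}))"

definition sd_error ::
    "real \<times> real \<Rightarrow> nat \<Rightarrow> (real \<times> real \<Rightarrow> complex) \<Rightarrow> (real \<Rightarrow> int \<times> int \<Rightarrow> complex^6) \<Rightarrow>
     real \<Rightarrow> int \<times> int \<Rightarrow> complex^6" where
  "sd_error \<omega> N v0 u t \<eta> = u t \<eta> - sd_lagrange N (exact_solution \<omega> v0 t) \<eta>"

definition sd_has_order :: "real \<times> real \<Rightarrow> nat \<Rightarrow> bool" where
  "sd_has_order \<omega> q \<longleftrightarrow>
     (\<forall>v0. periodic1 v0 \<and> C_k (q + 1) v0 \<longrightarrow>
       (\<exists>c1 c2 :: real. \<forall>N>0. \<forall>u. sd_solution \<omega> N v0 u \<longrightarrow>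
         (\<forall>t\<ge>0. mesh_norm N (sd_error \<omega> N v0 u t) \<le> (c1 + c2 * t) * (1 / real N) ^ q)))"

definition sd_optimal_order :: "real \<times> real \<Rightarrow> nat \<Rightarrow> bool" where
  "sd_optimal_order \<omega> q \<longleftrightarrow> sd_has_order \<omega> q \<and> (\<forall>q'. sd_has_order \<omega> q' \<longrightarrow> q' \<le> q)"

end

theory Submission
  imports Defs
begin

text \<open>
  Write \<open>h = 1 / N\<close>.  The error \<open>\<epsilon> = u - \<Pi> v\<close> satisfies
  \<open>\<epsilon>' = - (1 / h) L \<epsilon> - \<rho>\<close>, where the residual \<open>\<rho>\<close> is what is left when the interpolated
  exact solution is put into the scheme.  So the order is decided by stability, by the size of
  \<open>\<rho>\<close>, and by the part of \<open>\<rho>\<close> that \<open>L\<close> can absorb.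

  Stability.  On a triangle \<open>e\<close> with centre \<open>c\<close> the condition \<open>f(c) = \<omega> u(c)\<close> fixes the mean value
  of the flux only up to a term proportional to the gradient of \<open>div f = - u\<^sub>t\<close>.  Testing with a
  linear function therefore gives the upwind discontinuous Galerkin scheme in which the mass form
  \<open>\<integral> \<phi> \<psi>\<close> is replaced by
  \<open>\<integral> \<phi> \<psi> + (1/3) \<integral> (\<phi> - mean \<phi>) (\<psi> - mean \<psi>)\<close>.  In this inner product (\<open>energy_form\<close>)
  the scheme dissipates: the change of energy is minus a sum of squared jumps over the edges
  (\<open>energy_form_x\<close>, \<open>energy_form_y\<close>).  Hence a right-hand side of size \<open>K\<close> makes the norm grow by at
  most \<open>O(K t)\<close>, uniformly in \<open>h\<close> (\<open>sd_stability\<close>).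

  Order from below.  The scheme is exact on affine functions, so \<open>\<rho> = O(h)\<close> for data in \<open>C\<^sup>2\<close>
  (\<open>sd_residual_order1\<close>), which is order 1.  For data in \<open>C\<^sup>3\<close> one has \<open>\<rho> = h q + O(h\<^sup>2)\<close> with \<open>q\<close> linear
  in the second derivatives of \<open>v\<close> (\<open>sd_residual_order2\<close>).  If both components of \<open>\<omega>\<close> are positive, then
  \<open>q = - (\<Sum>\<^sub>\<zeta> L\<^sub>\<zeta>) c\<close> for a vector \<open>c\<close> that is again linear in the second derivatives
  (\<open>correction_exists\<close>).  The modified error \<open>\<epsilon> - h\<^sup>2 c\<close> then has a right-hand side of size
  \<open>O(h\<^sup>2)\<close>, and order 2 follows.

  Order from above.  Take \<open>v\<^sub>0(x, y) = exp (2 \<pi> \<i> x)\<close>.  The scheme acts on this Fourier mode as a linear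
  ODE in six unknowns, and the mesh norm of the error is the norm of the amplitude of the error.
  If that amplitude were \<open>O(h\<^sup>3)\<close>, integrating the error equation over \<open>0 \<le> t \<le> 1\<close> would bound \<open>\<rho>\<close> by
  \<open>O(h\<^sup>2)\<close>, but \<open>q \<noteq> 0\<close>.  So the order is below 3.  If \<open>\<omega>\<^sub>y = 0\<close>, the horizontal strips of the mesh do not
  interact, and besides the mass of a strip also its first moment in \<open>y\<close> is conserved.  This gives
  a second left null vector \<open>\<mu>\<close> of \<open>\<Sum>\<^sub>\<zeta> L\<^sub>\<zeta>\<close>, and \<open>\<mu> \<cdot> q \<noteq> 0\<close>.  Pairing the error equation with
  \<open>\<mu>\<close> gains one power of \<open>h\<close> in the term \<open>(1 / h) L \<epsilon>\<close>, so already an \<open>O(h\<^sup>2)\<close> error is contradictory.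
  Both cases are instances of \<open>sd_order_obstruction\<close>.
\<close>

section \<open>Dissipation of the energy\<close>

lemma UNIV_6: "(UNIV :: 6 set) = {1, 2, 3, 4, 5, 6}"
proof -
  have "x = 1 \<or> x = 2 \<or> x = 3 \<or> x = 4 \<or> x = 5 \<or> x = 6" for x :: 6
  proof (induct x)
    case (of_int z)
    then have "z = 0 \<or> z = 1 \<or> z = 2 \<or> z = 3 \<or> z = 4 \<or> z = 5" by fastforce
    then show ?case by auto
  qed
  then show ?thesis by auto
qed

lemma sum_6: "sum f (UNIV :: 6 set) = f 1 + f 2 + f 3 + f 4 + f 5 + f 6"
  unfolding UNIV_6 by (simp add: ac_simps)

lemma forall_6: "(\<forall>i::6. P i) \<longleftrightarrow> P 1 \<and> P 2 \<and> P 3 \<and> P 4 \<and> P 5 \<and> P 6"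
  using UNIV_6 by (metis UNIV_I insert_iff singletonD)

lemma sum_stencil: "sum f sd_stencil = f (0, 0) + f (-1, 0) + f (0, -1)"
  by (simp add: sd_stencil_def add.assoc)

text \<open>
  Up to the factor 27 divided by the area of a triangle, this is the mass form of the introduction,
  written in vertex values and summed over the two triangles of a block.
\<close>

definition energy_form :: "complex^6 \<Rightarrow> complex^6 \<Rightarrow> real" where
  "energy_form a b = 3 * (a \<bullet> b)
     + 2 * ((a$1 + a$2 + a$3) \<bullet> (b$1 + b$2 + b$3))
     + 2 * ((a$4 + a$5 + a$6) \<bullet> (b$4 + b$5 + b$6))"

text \<open>
  Three times the mean of \<open>|u|\<^sup>2\<close> over an edge on which \<open>u\<close> is linear with end values \<open>p\<close> and \<open>q\<close>.
\<close>

definition edge_form :: "complex \<Rightarrow> complex \<Rightarrow> real" where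
  "edge_form p q = p \<bullet> p + p \<bullet> q + q \<bullet> q"

lemma edge_form_nonneg: "edge_form p q \<ge> 0"
proof -
  have "2 * edge_form p q = p \<bullet> p + q \<bullet> q + (p + q) \<bullet> (p + q)"
    by (simp add: edge_form_def inner_add inner_commute)
  then show ?thesis
    by (smt (verit) inner_ge_zero)
qed

text \<open>
  The energy balance of a block for the velocity \<open>(1, 0)\<close>: outflow through the right side minus the
  outflow of the left neighbour \<open>b\<close>, plus the upwind jumps across the left side and across the diagonal.
  The first two terms telescope in a sum over a period.
\<close>

lemma energy_form_x:
  "energy_form a (sd_Lx (0,0) *v a + sd_Lx (-1,0) *v b) =
    9 * (edge_form (a$5) (a$6) - edge_form (b$5) (b$6)
         + edge_form (a$1 - b$6) (a$3 - b$5) + edge_form (a$4 - a$3) (a$6 - a$2))"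
  unfolding energy_form_def edge_form_def
  by (simp add: sd_Lx_def inner_vec_def sum_6 matrix_vector_mult_def inner_complex_def)
     (simp add: algebra_simps power2_eq_square)

lemma energy_form_y:
  "energy_form a (sd_Ly (0,0) *v a + sd_Ly (0,-1) *v c) =
    9 * (edge_form (a$4) (a$5) - edge_form (c$4) (c$5)
         + edge_form (a$1 - c$4) (a$2 - c$5) + edge_form (a$4 - a$3) (a$6 - a$2))"
  unfolding energy_form_def edge_form_def
  by (simp add: sd_Ly_def inner_vec_def sum_6 matrix_vector_mult_def inner_complex_def)
     (simp add: algebra_simps power2_eq_square)

lemma energy_form_commute: "energy_form a b = energy_form b a"
  by (simp add: energy_form_def inner_commute)

lemma energy_form_bound: "\<bar>energy_form a b\<bar> \<le> 39 * (norm a * norm b)"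
proof -
  have comp: "norm (v$i + v$j + v$k) \<le> 3 * norm v" for v :: "complex^6" and i j k
    using norm_triangle_ineq[of "v$i + v$j" "v$k"] norm_triangle_ineq[of "v$i" "v$j"]
      Finite_Cartesian_Product.norm_nth_le[of v i] Finite_Cartesian_Product.norm_nth_le[of v j]
      Finite_Cartesian_Product.norm_nth_le[of v k] by linarith
  have "\<bar>(a$i + a$j + a$k) \<bullet> (b$i + b$j + b$k)\<bar> \<le> (3 * norm a) * (3 * norm b)" for i j k
    by (rule order_trans[OF Cauchy_Schwarz_ineq2]) (intro mult_mono comp; simp)
  from this[of 1 2 3] this[of 4 5 6] Cauchy_Schwarz_ineq2[of a b] show ?thesis
    unfolding energy_form_def by linarith
qed

lemma bounded_bilinear_energy_form: "bounded_bilinear energy_form"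
proof
  show "\<exists>K. \<forall>a b. norm (energy_form a b) \<le> norm a * norm b * K"
    using energy_form_bound by (intro exI[of _ 39]) (simp add: mult.commute)
qed (simp_all add: energy_form_def inner_add_left inner_add_right algebra_simps)

interpretation energy_form: bounded_bilinear energy_form
  by (rule bounded_bilinear_energy_form)

lemma energy_form_ge: "3 * (norm a)\<^sup>2 \<le> energy_form a a"
  unfolding energy_form_def dot_square_norm by simp

lemma energy_form_le: "energy_form a a \<le> 39 * (norm a)\<^sup>2"
  using energy_form_bound[of a a] by (simp add: power2_eq_square)

lemma energy_form_nonneg: "0 \<le> energy_form a a"
  using energy_form_ge[of a] by (smt (verit) zero_le_power2)

text \<open>
  The form of the Cauchy inequality that yields the growth bound below with a constant weight \<open>c\<close> for all
  blocks, so that sums over the mesh need no separate inequality.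
\<close>

lemma energy_form_Young:
  assumes "c > 0"
  shows "- 2 * energy_form a b \<le> c * energy_form a a + energy_form b b / c"
proof -
  have "0 \<le> energy_form (c *\<^sub>R a + b) (c *\<^sub>R a + b)"
    by (rule energy_form_nonneg)
  also have "\<dots> = c * (c * energy_form a a + 2 * energy_form a b + energy_form b b / c)"
    using assms
    by (simp add: energy_form.add_left energy_form.add_right energy_form.scaleR_left
        energy_form.scaleR_right energy_form_commute[of b a] field_simps)
  finally show ?thesis
    using assms by (simp add: zero_le_mult_iff)
qed

section \<open>Stability\<close>

definition sd_op :: "real \<times> real \<Rightarrow> (int \<times> int \<Rightarrow> complex^6) \<Rightarrow> int \<times> int \<Rightarrow> complex^6" where
  "sd_op \<omega> w \<eta> = (\<Sum>\<zeta>\<in>sd_stencil. sd_L \<omega> \<zeta> *v w (\<eta> + \<zeta>))"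

lemma sum_shift_int:
  fixes f :: "int \<Rightarrow> 'b::ab_group_add"
  assumes "N > 0" and "\<And>i. f (i + int N) = f i"
  shows "(\<Sum>i\<in>{1..int N}. f (i - 1)) = (\<Sum>i\<in>{1..int N}. f i)"
proof -
  have "(\<Sum>i\<in>{1..int N}. f (i - 1)) = (\<Sum>i\<in>{0..int N - 1}. f i)"
    by (rule sum.reindex_bij_witness[of _ "\<lambda>i. i + 1" "\<lambda>i. i - 1"]) auto
  also have "{0..int N - 1} = insert 0 {1..int N - 1}"
    using assms(1) by auto
  also have "sum f \<dots> = f (int N) + sum f {1..int N - 1}"
    using assms(2)[of 0] by simp
  also have "\<dots> = sum f (insert (int N) {1..int N - 1})"
    by simp
  also have "insert (int N) {1..int N - 1} = {1..int N}"
    using assms(1) by auto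
  finally show ?thesis .
qed

lemma sum_shift_block:
  fixes g :: "int \<times> int \<Rightarrow> real"
  assumes N: "N > 0"
    and per: "\<And>i j. g (i + int N, j) = g (i, j)" "\<And>i j. g (i, j + int N) = g (i, j)"
  shows "(\<Sum>\<eta>\<in>{1..int N} \<times> {1..int N}. g (\<eta> + (-1, 0))) = (\<Sum>\<eta>\<in>{1..int N} \<times> {1..int N}. g \<eta>)"
    and "(\<Sum>\<eta>\<in>{1..int N} \<times> {1..int N}. g (\<eta> + (0, -1))) = (\<Sum>\<eta>\<in>{1..int N} \<times> {1..int N}. g \<eta>)"
proof -
  have "(\<Sum>\<eta>\<in>{1..int N} \<times> {1..int N}. g (\<eta> + (-1, 0))) = (\<Sum>i\<in>{1..int N}. \<Sum>j\<in>{1..int N}. g (i - 1, j))"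
    by (simp add: sum.cartesian_product case_prod_beta' plus_prod_def)
  also have "\<dots> = (\<Sum>i\<in>{1..int N}. \<Sum>j\<in>{1..int N}. g (i, j))"
    by (rule sum_shift_int[OF N]) (simp add: per)
  finally show "(\<Sum>\<eta>\<in>{1..int N} \<times> {1..int N}. g (\<eta> + (-1, 0))) = (\<Sum>\<eta>\<in>{1..int N} \<times> {1..int N}. g \<eta>)"
    by (simp add: sum.cartesian_product)
  have "(\<Sum>\<eta>\<in>{1..int N} \<times> {1..int N}. g (\<eta> + (0, -1))) = (\<Sum>i\<in>{1..int N}. \<Sum>j\<in>{1..int N}. g (i, j - 1))"
    by (simp add: sum.cartesian_product case_prod_beta' plus_prod_def)
  also have "\<dots> = (\<Sum>i\<in>{1..int N}. \<Sum>j\<in>{1..int N}. g (i, j))"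
    by (intro sum.cong refl sum_shift_int[OF N]) (simp add: per)
  finally show "(\<Sum>\<eta>\<in>{1..int N} \<times> {1..int N}. g (\<eta> + (0, -1))) = (\<Sum>\<eta>\<in>{1..int N} \<times> {1..int N}. g \<eta>)"
    by (simp add: sum.cartesian_product)
qed

lemma sd_op_split:
  "sd_op \<omega> w \<eta> =
     fst \<omega> *\<^sub>R (sd_Lx (0,0) *v w \<eta> + sd_Lx (-1,0) *v w (\<eta> + (-1,0)))
   + snd \<omega> *\<^sub>R (sd_Ly (0,0) *v w \<eta> + sd_Ly (0,-1) *v w (\<eta> + (0,-1)))"
proof -
  have "sd_Lx (0,-1) = 0" "sd_Ly (-1,0) = 0"
    by (simp_all add: sd_Lx_def sd_Ly_def)
  moreover have "\<eta> + (0, 0) = \<eta>" by (simp add: prod_eq_iff)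
  moreover have "(c *\<^sub>R A) *v x = c *\<^sub>R (A *v x)" for c and A :: "complex^6^6" and x
    by (simp add: matrix_vector_mult_def vec_eq_iff scaleR_sum_right)
  ultimately show ?thesis
    by (simp add: sd_op_def sum_stencil sd_L_def matrix_vector_mult_add_rdistrib scaleR_add_right
        del: zero_prod_def)
qed

lemma sd_op_dissipative:
  assumes "N > 0" "fst \<omega> \<ge> 0" "snd \<omega> \<ge> 0" and per: "mesh_periodic N w"
  shows "0 \<le> (\<Sum>\<eta>\<in>{1..int N} \<times> {1..int N}. energy_form (w \<eta>) (sd_op \<omega> w \<eta>))"
proof -
  define p where "p \<eta> = edge_form (w \<eta> $ 5) (w \<eta> $ 6)" for \<eta>
  define q where "q \<eta> = edge_form (w \<eta> $ 4) (w \<eta> $ 5)" for \<eta>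
  have w: "w (i + int N, j) = w (i, j)" "w (i, j + int N) = w (i, j)" for i j
    using per by (auto simp: mesh_periodic_def)
  have tele: "9 * fst \<omega> * (p \<eta> - p (\<eta> + (-1,0))) + 9 * snd \<omega> * (q \<eta> - q (\<eta> + (0,-1)))
      \<le> energy_form (w \<eta>) (sd_op \<omega> w \<eta>)" for \<eta>
  proof -
    have "0 \<le> fst \<omega> * edge_form a b" "0 \<le> snd \<omega> * edge_form a b" for a b
      using assms(2,3) edge_form_nonneg by simp_all
    from this(1)[of "w \<eta> $ 1 - w (\<eta> + (-1,0)) $ 6" "w \<eta> $ 3 - w (\<eta> + (-1,0)) $ 5"]
      this(1)[of "w \<eta> $ 4 - w \<eta> $ 3" "w \<eta> $ 6 - w \<eta> $ 2"]
      this(2)[of "w \<eta> $ 1 - w (\<eta> + (0,-1)) $ 4" "w \<eta> $ 2 - w (\<eta> + (0,-1)) $ 5"]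
      this(2)[of "w \<eta> $ 4 - w \<eta> $ 3" "w \<eta> $ 6 - w \<eta> $ 2"]
    show ?thesis
      unfolding sd_op_split energy_form.add_right[of _ "fst \<omega> *\<^sub>R _"] energy_form.scaleR_right
        energy_form_x energy_form_y p_def q_def
      by (simp add: algebra_simps)
  qed
  have "(\<Sum>\<eta>\<in>{1..int N} \<times> {1..int N}.
      9 * fst \<omega> * (p \<eta> - p (\<eta> + (-1,0))) + 9 * snd \<omega> * (q \<eta> - q (\<eta> + (0,-1)))) = 0"
    using sum_shift_block[OF assms(1), of p] sum_shift_block[OF assms(1), of q]
    by (simp add: sum.distrib sum_distrib_left[symmetric] sum_subtractf p_def q_def w)
  then show ?thesis
    by (metis (no_types, lifting) sum_mono tele)
qed

text \<open>
  The energy \<open>F\<close> satisfies \<open>F' \<le> const * K * sqrt F\<close>, so \<open>sqrt F\<close> grows at most linearly.  Since \<open>sqrt\<close> is not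
  differentiable at 0, the proof differentiates \<open>sqrt (F + 10 K0\<^sup>2)\<close>; the constant \<open>10 K0\<^sup>2\<close> completes the
  bound \<open>39 K0\<^sup>2\<close> of \<open>F 0\<close> to the square \<open>(7 K0)\<^sup>2\<close>.
\<close>

theorem sd_stability:
  assumes N: "N > 0" and \<omega>: "fst \<omega> \<ge> 0" "snd \<omega> \<ge> 0"
    and per: "\<And>t. t \<ge> 0 \<Longrightarrow> mesh_periodic N (w t)"
    and der: "\<And>t \<eta>. t \<ge> 0 \<Longrightarrow> ((\<lambda>s. w s \<eta>) has_vector_derivative
               - (real N *\<^sub>R sd_op \<omega> (w t) \<eta>) - \<tau> t \<eta>) (at t within {0..})"
    and K0: "K0 > 0" "\<And>\<eta>. norm (w 0 \<eta>) \<le> K0"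
    and K: "K > 0" "\<And>t \<eta>. t \<ge> 0 \<Longrightarrow> norm (\<tau> t \<eta>) \<le> K"
    and t: "t \<ge> 0"
  shows "mesh_norm N (w t) \<le> 7 * (K0 + K * t)"
proof -
  define B where "B = {1..int N} \<times> {1..int N}"
  define h2 where "h2 = (1 / real N)\<^sup>2"
  have h2: "h2 \<ge> 0" "h2 * real (card B) = 1"
    using N by (simp_all add: h2_def B_def card_cartesian_product power2_eq_square)
  have avg: "h2 * (\<Sum>\<eta>\<in>B. c) = c" for c :: real
    using h2(2) by simp
  define F where "F s = h2 * (\<Sum>\<eta>\<in>B. energy_form (w s \<eta>) (w s \<eta>))" for s
  define F' where "F' s = h2 * (\<Sum>\<eta>\<in>B. 2 * energy_form (w s \<eta>)
      (- (real N *\<^sub>R sd_op \<omega> (w s) \<eta>) - \<tau> s \<eta>))" for s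
  define \<Phi> where "\<Phi> s = sqrt (F s + 10 * K0\<^sup>2)" for s
  have F_nonneg: "F s \<ge> 0" for s
    unfolding F_def by (intro mult_nonneg_nonneg sum_nonneg h2 energy_form_nonneg)
  have \<Phi>_pos: "\<Phi> s > 0" and \<Phi>_sq: "\<Phi> s * \<Phi> s = F s + 10 * K0\<^sup>2" for s
    using F_nonneg[of s] K0(1) by (simp_all add: \<Phi>_def add_nonneg_pos)
  have F_der: "(F has_real_derivative F' s) (at s within {0..})" if "s \<ge> 0" for s
  proof -
    have "((\<lambda>s. energy_form (w s \<eta>) (w s \<eta>)) has_vector_derivative
        2 * energy_form (w s \<eta>) (- (real N *\<^sub>R sd_op \<omega> (w s) \<eta>) - \<tau> s \<eta>)) (at s within {0..})" for \<eta>
      using energy_form.has_vector_derivative[OF der[OF that] der[OF that], of \<eta> \<eta>]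
      by (simp add: energy_form_commute)
    then have "((\<lambda>s. \<Sum>\<eta>\<in>B. energy_form (w s \<eta>) (w s \<eta>)) has_vector_derivative
        (\<Sum>\<eta>\<in>B. 2 * energy_form (w s \<eta>) (- (real N *\<^sub>R sd_op \<omega> (w s) \<eta>) - \<tau> s \<eta>))) (at s within {0..})"
      by (intro has_vector_derivative_sum)
    then show ?thesis
      unfolding F_def F'_def has_real_derivative_iff_has_vector_derivative[symmetric]
      by (rule DERIV_cmult)
  qed
  have F'_le: "F' s \<le> 14 * K * \<Phi> s" if "s \<ge> 0" for s
  proof -
    \<comment> \<open>This weight balances the two terms of Young's inequality: each is at most \<open>7 K \<Phi>\<close>.\<close>
    define c where "c = 7 * K / \<Phi> s"
    have c: "c > 0"
      using K(1) \<Phi>_pos by (simp add: c_def)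
    have "2 * energy_form (w s \<eta>) (- (real N *\<^sub>R sd_op \<omega> (w s) \<eta>) - \<tau> s \<eta>)
        \<le> - 2 * real N * energy_form (w s \<eta>) (sd_op \<omega> (w s) \<eta>)
          + (c * energy_form (w s \<eta>) (w s \<eta>) + 39 * K\<^sup>2 / c)" for \<eta>
    proof -
      have "(norm (\<tau> s \<eta>))\<^sup>2 \<le> K\<^sup>2"
        using K(2)[OF that] by (simp add: power_mono)
      then have "energy_form (\<tau> s \<eta>) (\<tau> s \<eta>) \<le> 39 * K\<^sup>2"
        using energy_form_le[of "\<tau> s \<eta>"] by linarith
      then have "energy_form (\<tau> s \<eta>) (\<tau> s \<eta>) / c \<le> 39 * K\<^sup>2 / c"
        using c by (simp add: divide_right_mono)
      then show ?thesis
        using energy_form_Young[OF c, of "w s \<eta>" "\<tau> s \<eta>"]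
        by (simp add: energy_form.diff_right energy_form.minus_right energy_form.scaleR_right)
    qed
    then have "F' s \<le> h2 * (\<Sum>\<eta>\<in>B. - 2 * real N * energy_form (w s \<eta>) (sd_op \<omega> (w s) \<eta>)
          + (c * energy_form (w s \<eta>) (w s \<eta>) + 39 * K\<^sup>2 / c))"
      unfolding F'_def by (intro mult_left_mono sum_mono h2)
    also have "\<dots> = - 2 * real N * h2 * (\<Sum>\<eta>\<in>B. energy_form (w s \<eta>) (sd_op \<omega> (w s) \<eta>))
          + c * F s + 39 * K\<^sup>2 / c"
      unfolding F_def sum.distrib sum_distrib_left[symmetric] distrib_left avg by simp
    also have "\<dots> \<le> c * F s + 39 * K\<^sup>2 / c"
      using sd_op_dissipative[OF N \<omega> per[OF that]] h2(1) by (simp add: B_def[symmetric])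
    also have "\<dots> \<le> 7 * K * \<Phi> s + 7 * K * \<Phi> s"
    proof (rule add_mono)
      have "F s \<le> \<Phi> s * \<Phi> s"
        using \<Phi>_sq by simp
      then have "c * F s \<le> c * (\<Phi> s * \<Phi> s)"
        using c by simp
      then show "c * F s \<le> 7 * K * \<Phi> s"
        using \<Phi>_pos[of s] by (simp add: c_def)
      show "39 * K\<^sup>2 / c \<le> 7 * K * \<Phi> s"
        using \<Phi>_pos[of s] K(1) by (simp add: c_def field_simps power2_eq_square)
    qed
    finally show ?thesis by simp
  qed
  have \<Phi>_der: "(\<Phi> has_real_derivative F' s / (2 * \<Phi> s)) (at s within {0..})" if "s \<ge> 0" for s
  proof -
    have "F s + 10 * K0\<^sup>2 > 0"
      using F_nonneg[of s] K0(1) by (simp add: add_nonneg_pos)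
    then show ?thesis
      unfolding \<Phi>_def
      by (auto intro!: derivative_eq_intros F_der[OF that] simp: field_simps)
  qed
  have \<Phi>_le: "\<Phi> t \<le> \<Phi> 0 + 7 * K * t"
  proof (cases "t = 0")
    case False
    with t have "0 < t" by simp
    have "\<exists>x\<in>{0<..<t}. \<Phi> t - \<Phi> 0 = (\<lambda>d. F' x / (2 * \<Phi> x) * d) (t - 0)"
    proof (rule mvt_simple[OF \<open>0 < t\<close>])
      fix x assume "0 \<le> x" "x \<le> t"
      then have "(\<Phi> has_real_derivative F' x / (2 * \<Phi> x)) (at x within {0..t})"
        by (intro DERIV_subset[OF \<Phi>_der]) auto
      then show "(\<Phi> has_derivative (\<lambda>d. F' x / (2 * \<Phi> x) * d)) (at x within {0..t})"
        unfolding has_field_derivative_def .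
    qed
    then obtain x where x: "x \<in> {0<..<t}" "\<Phi> t - \<Phi> 0 = F' x / (2 * \<Phi> x) * t"
      by auto
    have "F' x / (2 * \<Phi> x) \<le> 7 * K"
      using F'_le[of x] x(1) \<Phi>_pos[of x] by (simp add: field_simps)
    then have "F' x / (2 * \<Phi> x) * t \<le> 7 * K * t"
      using t by (rule mult_right_mono)
    then show ?thesis using x(2) by linarith
  qed simp
  have "F 0 \<le> h2 * (\<Sum>\<eta>\<in>B. 39 * K0\<^sup>2)"
    unfolding F_def
  proof (intro mult_left_mono sum_mono h2)
    fix \<eta>
    have "(norm (w 0 \<eta>))\<^sup>2 \<le> K0\<^sup>2"
      using K0(2) by (simp add: power_mono)
    then show "energy_form (w 0 \<eta>) (w 0 \<eta>) \<le> 39 * K0\<^sup>2"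
      using energy_form_le[of "w 0 \<eta>"] by linarith
  qed
  then have "F 0 + 10 * K0\<^sup>2 \<le> (7 * K0)\<^sup>2"
    unfolding avg by (simp add: power_mult_distrib)
  then have \<Phi>0: "\<Phi> 0 \<le> 7 * K0"
    unfolding \<Phi>_def using K0(1) by (intro real_le_lsqrt) auto
  have "mesh_norm N (w t) = sqrt (h2 * (\<Sum>\<eta>\<in>B. (norm (w t \<eta>))\<^sup>2))"
    by (simp add: mesh_norm_def h2_def B_def sum_distrib_left)
  also have "\<dots> \<le> \<Phi> t"
  proof -
    have "(norm a)\<^sup>2 \<le> energy_form a a" for a
      using energy_form_ge[of a] by (smt (verit) zero_le_power2)
    then have "h2 * (\<Sum>\<eta>\<in>B. (norm (w t \<eta>))\<^sup>2) \<le> F t"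
      unfolding F_def by (intro mult_left_mono sum_mono h2)
    then show ?thesis
      unfolding \<Phi>_def by (intro real_sqrt_le_mono) (smt (verit) zero_le_power2)
  qed
  also have "\<dots> \<le> 7 * (K0 + K * t)"
    using \<Phi>_le \<Phi>0 by (simp add: algebra_simps)
  finally show ?thesis .
qed

section \<open>Directional derivatives, Taylor estimates and periodic functions\<close>

definition dirderiv :: "'a \<Rightarrow> ('a::real_normed_vector \<Rightarrow> 'b::real_normed_vector) \<Rightarrow> 'a \<Rightarrow> 'b" where
  "dirderiv b f x = frechet_derivative f (at x) b"

lemma C_k_Suc_iff:
  "C_k (Suc k) f \<longleftrightarrow> (\<forall>x. f differentiable (at x)) \<and> (\<forall>b. C_k k (dirderiv b f))"
  by (simp add: dirderiv_def[abs_def])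

lemma C_k_SucD:
  assumes "C_k (Suc k) f"
  shows "C_k k f"
  using assms
proof (induction k arbitrary: f)
  case 0
  then show ?case
    by (auto intro: differentiable_imp_continuous_within continuous_at_imp_continuous_on)
next
  case (Suc k)
  then show ?case
    unfolding C_k_Suc_iff[of "Suc k"] C_k_Suc_iff[of k f] by blast
qed

lemma dirderiv_add:
  "f differentiable (at x) \<Longrightarrow> dirderiv (a + b) f x = dirderiv a f x + dirderiv b f x"
  by (simp add: dirderiv_def linear_add linear_frechet_derivative)

lemma dirderiv_scaleR:
  "f differentiable (at x) \<Longrightarrow> dirderiv (c *\<^sub>R b) f x = c *\<^sub>R dirderiv b f x"
  by (simp add: dirderiv_def linear_scale linear_frechet_derivative)

lemma dirderiv_sum_fun:
  assumes "f differentiable (at x)" "g differentiable (at x)"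
  shows "dirderiv b (\<lambda>x. c *\<^sub>R f x + d *\<^sub>R g x) x = c *\<^sub>R dirderiv b f x + d *\<^sub>R dirderiv b g x"
proof -
  have "((\<lambda>x. c *\<^sub>R f x + d *\<^sub>R g x) has_derivative
      (\<lambda>b. c *\<^sub>R frechet_derivative f (at x) b + d *\<^sub>R frechet_derivative g (at x) b)) (at x)"
    using assms unfolding frechet_derivative_works by (auto intro!: derivative_eq_intros)
  from frechet_derivative_at[OF this] show ?thesis
    by (simp add: dirderiv_def fun_eq_iff)
qed

lemma dirderiv_coords:
  fixes f :: "real \<times> real \<Rightarrow> 'b::real_normed_vector"
  assumes "f differentiable (at x)"
  shows "dirderiv b f x = fst b *\<^sub>R dirderiv (1, 0) f x + snd b *\<^sub>R dirderiv (0, 1) f x"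
proof -
  have "b = fst b *\<^sub>R (1, 0) + snd b *\<^sub>R (0, 1)"
    by (simp add: prod_eq_iff)
  then show ?thesis
    by (metis assms dirderiv_add dirderiv_scaleR)
qed

lemma dirderiv2_coords:
  fixes f :: "real \<times> real \<Rightarrow> 'b::real_normed_vector"
  assumes "C_k 2 f"
  shows "dirderiv a (dirderiv b f) x =
     (fst a * fst b) *\<^sub>R dirderiv (1, 0) (dirderiv (1, 0) f) x
   + (fst a * snd b) *\<^sub>R dirderiv (1, 0) (dirderiv (0, 1) f) x
   + (snd a * fst b) *\<^sub>R dirderiv (0, 1) (dirderiv (1, 0) f) x
   + (snd a * snd b) *\<^sub>R dirderiv (0, 1) (dirderiv (0, 1) f) x"
proof -
  have d: "f differentiable (at x)" "dirderiv b f differentiable (at x)" for b x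
    using assms unfolding numeral_2_eq_2 C_k_Suc_iff by (auto simp del: split_paired_All)
  have "dirderiv b f = (\<lambda>x. fst b *\<^sub>R dirderiv (1, 0) f x + snd b *\<^sub>R dirderiv (0, 1) f x)"
    by (rule ext) (rule dirderiv_coords[OF d(1)])
  then have "dirderiv a (dirderiv b f) x =
      fst b *\<^sub>R dirderiv a (dirderiv (1, 0) f) x + snd b *\<^sub>R dirderiv a (dirderiv (0, 1) f) x"
    using dirderiv_sum_fun[OF d(2) d(2)] by simp
  then show ?thesis
    unfolding dirderiv_coords[OF d(2), of a] by (simp add: algebra_simps)
qed

lemma dirderiv_along_line:
  assumes "\<And>x. f differentiable (at x)"
  shows "((\<lambda>s. f (x + s *\<^sub>R b)) has_vector_derivative dirderiv b f (x + s *\<^sub>R b)) (at s within S)"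
proof -
  have lin: "((\<lambda>s. x + s *\<^sub>R b) has_derivative (\<lambda>d. d *\<^sub>R b)) (at s within S)"
    by (auto intro!: derivative_eq_intros)
  have "(f has_derivative frechet_derivative f (at (x + s *\<^sub>R b))) (at (x + s *\<^sub>R b))"
    using assms frechet_derivative_works by blast
  from has_derivative_compose[OF lin this] show ?thesis
    by (simp add: has_vector_derivative_def dirderiv_def linear_scale linear_frechet_derivative assms)
qed

lemma norm_increment_le:
  fixes g :: "real \<Rightarrow> 'b::real_normed_vector"
  assumes "h \<ge> 0"
    and "\<And>s. 0 \<le> s \<Longrightarrow> s \<le> h \<Longrightarrow> (g has_vector_derivative g' s) (at s within {0..h})"
    and "\<And>s. 0 \<le> s \<Longrightarrow> s \<le> h \<Longrightarrow> norm (g' s) \<le> B"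
  shows "norm (g h - g 0) \<le> B * h"
proof -
  have "norm (g h - g 0) \<le> B * norm (h - 0)"
  proof (rule differentiable_bound[of "{0..h}" g "\<lambda>s d. d *\<^sub>R g' s"])
    fix s assume s: "s \<in> {0..h}"
    then show "(g has_derivative (\<lambda>d. d *\<^sub>R g' s)) (at s within {0..h})"
      using assms(2) by (auto simp: has_vector_derivative_def)
    show "onorm (\<lambda>d. d *\<^sub>R g' s) \<le> B"
    proof (rule onorm_le)
      fix d :: real
      show "norm (d *\<^sub>R g' s) \<le> B * norm d"
        using mult_left_mono[of "norm (g' s)" B "\<bar>d\<bar>"] assms(3)[of s] s by (simp add: mult.commute)
    qed
  qed (use assms(1) in auto)
  then show ?thesis using assms(1) by simp
qed

text \<open>
  The three Taylor estimates along a line need no sharp constants, so each follows from the previous one,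
  applied to the derivative, by the mean value inequality.  This works for complex values directly.
\<close>

lemma Taylor_order1:
  assumes "\<And>x. f differentiable (at x)" and "\<And>x. norm (dirderiv b f x) \<le> M" and "h \<ge> 0"
  shows "norm (f (x + h *\<^sub>R b) - f x) \<le> M * h"
  using norm_increment_le[OF assms(3), of "\<lambda>s. f (x + s *\<^sub>R b)", OF dirderiv_along_line[OF assms(1)] assms(2)]
  by simp

lemma Taylor_order2:
  assumes "\<And>x. f differentiable (at x)" "\<And>x. dirderiv b f differentiable (at x)"
    and M: "\<And>x. norm (dirderiv b (dirderiv b f) x) \<le> M" and h: "h \<ge> 0"
  shows "norm (f (x + h *\<^sub>R b) - f x - h *\<^sub>R dirderiv b f x) \<le> M * h ^ 2"
proof -
  have M0: "M \<ge> 0" using M norm_ge_zero order_trans by blast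
  have "norm ((f (x + h *\<^sub>R b) - h *\<^sub>R dirderiv b f x) - (f (x + 0 *\<^sub>R b) - 0 *\<^sub>R dirderiv b f x))
      \<le> (M * h) * h"
  proof (rule norm_increment_le[OF h])
    fix s :: real assume s: "0 \<le> s" "s \<le> h"
    show "((\<lambda>s. f (x + s *\<^sub>R b) - s *\<^sub>R dirderiv b f x) has_vector_derivative
        dirderiv b f (x + s *\<^sub>R b) - dirderiv b f x) (at s within {0..h})"
      by (auto intro!: derivative_eq_intros dirderiv_along_line[OF assms(1)])
    have "norm (dirderiv b f (x + s *\<^sub>R b) - dirderiv b f x) \<le> M * s"
      by (rule Taylor_order1) (use assms s in auto)
    also have "\<dots> \<le> M * h" using M0 s by (simp add: mult_left_mono)
    finally show "norm (dirderiv b f (x + s *\<^sub>R b) - dirderiv b f x) \<le> M * h" .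
  qed
  then show ?thesis by (simp add: power2_eq_square algebra_simps)
qed

lemma Taylor_order3:
  assumes "\<And>x. f differentiable (at x)" "\<And>x. dirderiv b f differentiable (at x)"
    "\<And>x. dirderiv b (dirderiv b f) differentiable (at x)"
    and M: "\<And>x. norm (dirderiv b (dirderiv b (dirderiv b f)) x) \<le> M" and h: "h \<ge> 0"
  shows "norm (f (x + h *\<^sub>R b) - f x - h *\<^sub>R dirderiv b f x
      - (h\<^sup>2 / 2) *\<^sub>R dirderiv b (dirderiv b f) x) \<le> M * h ^ 3"
proof -
  have M0: "M \<ge> 0" using M norm_ge_zero order_trans by blast
  let ?g = "\<lambda>s. f (x + s *\<^sub>R b) - s *\<^sub>R dirderiv b f x - (s\<^sup>2 / 2) *\<^sub>R dirderiv b (dirderiv b f) x"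
  have "norm (?g h - ?g 0) \<le> (M * h\<^sup>2) * h"
  proof (rule norm_increment_le[OF h])
    fix s :: real assume s: "0 \<le> s" "s \<le> h"
    show "(?g has_vector_derivative dirderiv b f (x + s *\<^sub>R b) - dirderiv b f x
        - s *\<^sub>R dirderiv b (dirderiv b f) x) (at s within {0..h})"
      by (auto intro!: derivative_eq_intros dirderiv_along_line[OF assms(1)])
    have "norm (dirderiv b f (x + s *\<^sub>R b) - dirderiv b f x - s *\<^sub>R dirderiv b (dirderiv b f) x) \<le> M * s\<^sup>2"
      by (rule Taylor_order2) (use assms s in auto)
    also have "\<dots> \<le> M * h\<^sup>2" using M0 s by (simp add: mult_left_mono power_mono)
    finally show "norm (dirderiv b f (x + s *\<^sub>R b) - dirderiv b f x - s *\<^sub>R dirderiv b (dirderiv b f) x)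
        \<le> M * h\<^sup>2" .
  qed
  then show ?thesis by (simp add: power2_eq_square power3_eq_cube algebra_simps)
qed

lemma periodic1_dirderiv:
  assumes "periodic1 v" and d: "\<And>x. v differentiable (at x)"
  shows "periodic1 (dirderiv b v)"
proof -
  have shift: "dirderiv b v (r + p) = dirderiv b v r" if p: "\<And>r. v (r + p) = v r" for p r
  proof -
    have v: "(v has_derivative frechet_derivative v (at (r + p))) (at (r + p))"
      using d frechet_derivative_works by blast
    have "((\<lambda>r. r + p) has_derivative (\<lambda>d. d)) (at r)"
      using has_derivative_add[OF has_derivative_ident has_derivative_const] by simp
    from has_derivative_compose[OF this v]
    have "((\<lambda>r. v (r + p)) has_derivative frechet_derivative v (at (r + p))) (at r)" .
    then have "(v has_derivative frechet_derivative v (at (r + p))) (at r)"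
      unfolding p .
    from frechet_derivative_at[OF this] show ?thesis
      by (simp add: dirderiv_def)
  qed
  have "v (r + (1, 0)) = v r" "v (r + (0, 1)) = v r" for r
    using assms(1) by (cases r; simp add: periodic1_def)+
  then show ?thesis
    unfolding periodic1_def using shift[of "(1, 0)" "(_, _)"] shift[of "(0, 1)" "(_, _)"] by simp
qed

lemma periodic1_int:
  assumes "periodic1 v"
  shows "v (x + of_int i, y + of_int j) = v (x, y)"
proof -
  have "v (x + of_int i, y) = v (x, y)" for x y
  proof (induction i rule: int_induct[where k = 0])
    case (step1 i)
    have "v (x + of_int i + 1, y) = v (x + of_int i, y)"
      using assms unfolding periodic1_def by blast
    then show ?case using step1 by (simp add: add.assoc)
  next
    case (step2 i)
    have "v (x + of_int (i - 1) + 1, y) = v (x + of_int (i - 1), y)"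
      using assms unfolding periodic1_def by blast
    then show ?case using step2 by simp
  qed simp
  moreover have "v (x, y + of_int j) = v (x, y)" for x y
  proof (induction j rule: int_induct[where k = 0])
    case (step1 i)
    have "v (x, y + of_int i + 1) = v (x, y + of_int i)"
      using assms unfolding periodic1_def by blast
    then show ?case using step1 by (simp add: add.assoc)
  next
    case (step2 i)
    have "v (x, y + of_int (i - 1) + 1) = v (x, y + of_int (i - 1))"
      using assms unfolding periodic1_def by blast
    then show ?case using step2 by simp
  qed simp
  ultimately show ?thesis by simp
qed

lemma periodic1_bounded:
  assumes "periodic1 v" "continuous_on UNIV v"
  shows "\<exists>M. \<forall>x. norm (v x) \<le> M"
proof -
  have "compact (v ` ({0..1} \<times> {0..1}))"
    by (rule compact_continuous_image[OF continuous_on_subset[OF assms(2) subset_UNIV]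
          compact_Times[OF compact_Icc compact_Icc]])
  then have "bounded (v ` ({0..1} \<times> {0..1}))"
    by (rule compact_imp_bounded)
  then obtain M where M: "\<And>x. x \<in> {0..1} \<times> {0..1} \<Longrightarrow> norm (v x) \<le> M"
    unfolding bounded_iff by blast
  have "norm (v x) \<le> M" for x
  proof -
    have "v x = v (frac (fst x), frac (snd x))"
      using periodic1_int[OF assms(1), of "frac (fst x)" "\<lfloor>fst x\<rfloor>" "frac (snd x)" "\<lfloor>snd x\<rfloor>"]
      by (simp add: frac_def)
    also have "norm \<dots> \<le> M"
      by (intro M) (auto simp: less_imp_le[OF frac_lt_1])
    finally show ?thesis .
  qed
  then show ?thesis by blast
qed

lemma periodic1_family_bounded:
  assumes "finite B" and "\<And>b. b \<in> B \<Longrightarrow> periodic1 (F b)" "\<And>b. b \<in> B \<Longrightarrow> continuous_on UNIV (F b)"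
  shows "\<exists>M. 0 \<le> M \<and> (\<forall>b\<in>B. \<forall>x. norm (F b x) \<le> M)"
  using assms
proof (induction B rule: finite_induct)
  case empty
  then show ?case by (intro exI[of _ 0]) simp
next
  case (insert b B)
  then obtain M where M: "0 \<le> M" "\<forall>b\<in>B. \<forall>x. norm (F b x) \<le> M" by auto
  obtain M' where "\<forall>x. norm (F b x) \<le> M'"
    using periodic1_bounded insert.prems by blast
  with M show ?case
    by (intro exI[of _ "max M M'"]) (auto simp: le_max_iff_disj)
qed

text \<open>
  Expanding \<open>f (x + h (a + b))\<close> once in a single step and once in the two steps \<open>h a\<close> and \<open>h b\<close> shows that the
  mean of \<open>D\<^sub>a D\<^sub>b f\<close> and \<open>D\<^sub>b D\<^sub>a f\<close> equals \<open>D\<^sub>a D\<^sub>b f\<close> up to \<open>O(h)\<close>.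
\<close>

lemma dirderiv_commute:
  fixes f :: "real \<times> real \<Rightarrow> complex"
  assumes per: "periodic1 f" and C: "C_k 3 f"
  shows "dirderiv a (dirderiv b f) x = dirderiv b (dirderiv a f) x"
proof -
  have d1: "f differentiable (at x)" and d2: "dirderiv a f differentiable (at x)"
    and d3: "dirderiv b (dirderiv a f) differentiable (at x)"
    and c: "continuous_on UNIV (dirderiv c (dirderiv b (dirderiv a f)))" for a b c x
    using C unfolding numeral_3_eq_3 C_k_Suc_iff C_k.simps(1) by (auto simp del: split_paired_All)
  have p: "periodic1 (dirderiv c (dirderiv b (dirderiv a f)))" for a b c
    by (intro periodic1_dirderiv per d1 d2 d3)
  have "\<exists>M. 0 \<le> M \<and> (\<forall>(c,b,a)\<in>{a, b, a + b} \<times> {a, b, a + b} \<times> {a, b, a + b}.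
      \<forall>x. norm (dirderiv c (dirderiv b (dirderiv a f)) x) \<le> M)"
    using periodic1_family_bounded[of "{a, b, a + b} \<times> {a, b, a + b} \<times> {a, b, a + b}"
        "\<lambda>(c,b,a). dirderiv c (dirderiv b (dirderiv a f))"] p c by (auto split: prod.splits)
  then obtain M where M0: "0 \<le> M" and M: "\<And>p q r x. p \<in> {a, b, a + b} \<Longrightarrow> q \<in> {a, b, a + b} \<Longrightarrow>
      r \<in> {a, b, a + b} \<Longrightarrow> norm (dirderiv p (dirderiv q (dirderiv r f)) x) \<le> M"
    by fastforce
  define D where "D = dirderiv b (dirderiv a f) x - dirderiv a (dirderiv b f) x"
  have est: "norm D \<le> (9 * M) * h" if h: "h > 0" for h :: real
  proof -
    define e1 where "e1 = f (x + h *\<^sub>R (a + b)) - f x - h *\<^sub>R dirderiv (a + b) f x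
      - (h\<^sup>2 / 2) *\<^sub>R dirderiv (a + b) (dirderiv (a + b) f) x"
    define e2 where "e2 = f (x + h *\<^sub>R a + h *\<^sub>R b) - f (x + h *\<^sub>R a) - h *\<^sub>R dirderiv b f (x + h *\<^sub>R a)
      - (h\<^sup>2 / 2) *\<^sub>R dirderiv b (dirderiv b f) (x + h *\<^sub>R a)"
    define e3 where "e3 = f (x + h *\<^sub>R a) - f x - h *\<^sub>R dirderiv a f x
      - (h\<^sup>2 / 2) *\<^sub>R dirderiv a (dirderiv a f) x"
    define e4 where "e4 = dirderiv b f (x + h *\<^sub>R a) - dirderiv b f x - h *\<^sub>R dirderiv a (dirderiv b f) x"
    define e5 where "e5 = dirderiv b (dirderiv b f) (x + h *\<^sub>R a) - dirderiv b (dirderiv b f) x"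
    have e: "norm e1 \<le> M * h ^ 3" "norm e2 \<le> M * h ^ 3" "norm e3 \<le> M * h ^ 3"
      unfolding e1_def e2_def e3_def by (rule Taylor_order3; use d1 d2 d3 M h in auto)+
    have e4: "norm e4 \<le> M * h ^ 2"
      unfolding e4_def by (rule Taylor_order2) (use d1 d2 d3 M h in auto)
    have e5: "norm e5 \<le> M * h"
      unfolding e5_def by (rule Taylor_order1) (use d1 d2 d3 M h in auto)
    have ab: "dirderiv (a + b) f = (\<lambda>x. 1 *\<^sub>R dirderiv a f x + 1 *\<^sub>R dirderiv b f x)"
      by (rule ext) (simp add: dirderiv_add[OF d1])
    have quad: "dirderiv (a + b) (dirderiv (a + b) f) x = dirderiv a (dirderiv a f) x + dirderiv b (dirderiv a f) x
        + dirderiv a (dirderiv b f) x + dirderiv b (dirderiv b f) x"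
      unfolding ab dirderiv_sum_fun[OF d2 d2] dirderiv_add[OF d2] by simp
    have lin: "dirderiv (a + b) f x = dirderiv a f x + dirderiv b f x"
      by (rule dirderiv_add[OF d1])
    have "(h\<^sup>2 / 2) *\<^sub>R D = e2 + e3 + h *\<^sub>R e4 + (h\<^sup>2 / 2) *\<^sub>R e5 - e1"
      unfolding D_def e1_def e2_def e3_def e4_def e5_def quad lin
      by (simp add: scaleR_conv_of_real add.assoc scaleR_add_right) (simp add: field_simps power2_eq_square)
    then have "h\<^sup>2 / 2 * norm D = norm (e2 + e3 + h *\<^sub>R e4 + (h\<^sup>2 / 2) *\<^sub>R e5 - e1)"
      by (metis abs_of_nonneg norm_scaleR zero_le_divide_iff zero_le_numeral zero_le_power2)
    also have "\<dots> \<le> norm e2 + norm e3 + h * norm e4 + h\<^sup>2 / 2 * norm e5 + norm e1"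
      using h by (smt (verit) norm_triangle_ineq norm_triangle_ineq4 norm_scaleR divide_nonneg_nonneg zero_le_power2)
    also have "\<dots> \<le> M * h ^ 3 + M * h ^ 3 + h * (M * h ^ 2) + h\<^sup>2 / 2 * (M * h) + M * h ^ 3"
      using e e4 e5 h by (intro add_mono mult_left_mono) auto
    also have "\<dots> \<le> h\<^sup>2 / 2 * (9 * M * h)"
      using M0 h by (simp add: power2_eq_square power3_eq_cube)
    finally show ?thesis
      using h by simp
  qed
  have "norm D \<le> 0"
  proof (rule field_le_epsilon)
    fix \<epsilon> :: real assume "\<epsilon> > 0"
    have "norm D \<le> (9 * M) * (\<epsilon> / (9 * M + 1))"
      using M0 \<open>\<epsilon> > 0\<close> by (intro est) auto
    also have "\<dots> \<le> \<epsilon>"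
      using M0 \<open>\<epsilon> > 0\<close> by (simp add: field_simps)
    finally show "norm D \<le> 0 + \<epsilon>" by simp
  qed
  then show ?thesis by (simp add: D_def)
qed

section \<open>The residual of the scheme\<close>

definition node :: "int \<times> int \<Rightarrow> 6 \<Rightarrow> real \<times> real" where
  "node \<zeta> \<xi> = (of_int (fst (\<zeta> + sd_vertex \<xi>)), of_int (snd (\<zeta> + sd_vertex \<xi>)))"

text \<open>
  The residual in a block with lower left corner \<open>x\<close> of the interpolant of \<open>v\<close> moving with velocity
  \<open>\<omega>\<close>, whose time derivative is \<open>- D\<^sub>\<omega> v\<close>.
\<close>

definition sd_residual ::
    "real \<times> real \<Rightarrow> nat \<Rightarrow> (real \<times> real \<Rightarrow> complex) \<Rightarrow> real \<times> real \<Rightarrow> complex^6" where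
  "sd_residual \<omega> N v x = (\<chi> \<xi>.
     real N *\<^sub>R (\<Sum>\<zeta>\<in>sd_stencil. \<Sum>\<xi>'\<in>UNIV. sd_L \<omega> \<zeta> $ \<xi> $ \<xi>' * v (x + (1 / real N) *\<^sub>R node \<zeta> \<xi>'))
     - dirderiv \<omega> v (x + (1 / real N) *\<^sub>R node (0, 0) \<xi>))"

text \<open>
  The residual for \<open>h = 1\<close> of a quadratic polynomial with second derivatives \<open>p = v\<^sub>x\<^sub>x\<close>, \<open>r = v\<^sub>x\<^sub>y\<close> and
  \<open>q = v\<^sub>y\<^sub>y\<close>.
\<close>

definition quadratic_residual ::
    "real \<times> real \<Rightarrow> complex \<Rightarrow> complex \<Rightarrow> complex \<Rightarrow> complex^6" where
  "quadratic_residual \<omega> p r q =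
     (let X = of_real (fst \<omega>); Y = of_real (snd \<omega>) in
      vector [(X * p + Y * q) / 2, (Y * q - X * p) / 2 - Y * r, (X * p - Y * q) / 2 - X * r,
              (X * p - Y * q) / 2 + Y * r, - (X * p + Y * q) / 2, (Y * q - X * p) / 2 + X * r])"

lemma sd_L_nth:
  "sd_L \<omega> \<zeta> $ \<xi> $ \<xi>' = of_real (fst \<omega>) * sd_Lx \<zeta> $ \<xi> $ \<xi>' + of_real (snd \<omega>) * sd_Ly \<zeta> $ \<xi> $ \<xi>'"
  unfolding sd_L_def by (simp add: scaleR_conv_of_real[symmetric])

text \<open>
  This identity and the next one say that the scheme is exact for constant and for linear functions; the
  third one computes its residual on quadratic polynomials.
\<close>

lemma sd_L_sum: "(\<Sum>\<zeta>\<in>sd_stencil. \<Sum>\<xi>'\<in>UNIV. sd_L \<omega> \<zeta> $ \<xi> $ \<xi>') = 0"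
proof -
  have "\<forall>\<xi>. (\<Sum>\<zeta>\<in>sd_stencil. \<Sum>\<xi>'\<in>UNIV. sd_L \<omega> \<zeta> $ \<xi> $ \<xi>') = 0"
    unfolding forall_6 sum_stencil sum_6 sd_L_nth sd_Lx_def sd_Ly_def
    by (simp add: algebra_simps)
  then show ?thesis by blast
qed

lemma sd_L_linear:
  "(\<Sum>\<zeta>\<in>sd_stencil. \<Sum>\<xi>'\<in>UNIV. sd_L \<omega> \<zeta> $ \<xi> $ \<xi>' *
      (of_real (fst (node \<zeta> \<xi>')) * p + of_real (snd (node \<zeta> \<xi>')) * q))
   = of_real (fst \<omega>) * p + of_real (snd \<omega>) * q"
proof -
  have "\<forall>\<xi>. (\<Sum>\<zeta>\<in>sd_stencil. \<Sum>\<xi>'\<in>UNIV. sd_L \<omega> \<zeta> $ \<xi> $ \<xi>' *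
      (of_real (fst (node \<zeta> \<xi>')) * p + of_real (snd (node \<zeta> \<xi>')) * q))
   = of_real (fst \<omega>) * p + of_real (snd \<omega>) * q"
    unfolding forall_6 sum_stencil sum_6 sd_L_nth sd_Lx_def sd_Ly_def node_def sd_vertex_def
    by (simp add: algebra_simps)
  then show ?thesis by blast
qed

lemma sd_L_quadratic:
  "(\<Sum>\<zeta>\<in>sd_stencil. \<Sum>\<xi>'\<in>UNIV. sd_L \<omega> \<zeta> $ \<xi> $ \<xi>' *
      ((of_real (fst (node \<zeta> \<xi>')))\<^sup>2 * p + 2 * of_real (fst (node \<zeta> \<xi>')) * of_real (snd (node \<zeta> \<xi>')) * r
       + (of_real (snd (node \<zeta> \<xi>')))\<^sup>2 * q)) / 2
   = of_real (fst (node (0, 0) \<xi>)) * of_real (fst \<omega>) * p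
     + (of_real (fst (node (0, 0) \<xi>)) * of_real (snd \<omega>) + of_real (snd (node (0, 0) \<xi>)) * of_real (fst \<omega>)) * r
     + of_real (snd (node (0, 0) \<xi>)) * of_real (snd \<omega>) * q
     + quadratic_residual \<omega> p r q $ \<xi>"
proof -
  have "\<forall>\<xi>. (\<Sum>\<zeta>\<in>sd_stencil. \<Sum>\<xi>'\<in>UNIV. sd_L \<omega> \<zeta> $ \<xi> $ \<xi>' *
      ((of_real (fst (node \<zeta> \<xi>')))\<^sup>2 * p + 2 * of_real (fst (node \<zeta> \<xi>')) * of_real (snd (node \<zeta> \<xi>')) * r
       + (of_real (snd (node \<zeta> \<xi>')))\<^sup>2 * q)) / 2
   = of_real (fst (node (0, 0) \<xi>)) * of_real (fst \<omega>) * p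
     + (of_real (fst (node (0, 0) \<xi>)) * of_real (snd \<omega>) + of_real (snd (node (0, 0) \<xi>)) * of_real (fst \<omega>)) * r
     + of_real (snd (node (0, 0) \<xi>)) * of_real (snd \<omega>) * q
     + quadratic_residual \<omega> p r q $ \<xi>"
    unfolding forall_6 sum_stencil sum_6 sd_L_nth sd_Lx_def sd_Ly_def node_def sd_vertex_def
      quadratic_residual_def Let_def
    by (simp add: field_simps)
  then show ?thesis by blast
qed

lemma norm_vec6_le:
  fixes x :: "complex^6"
  assumes "\<And>\<xi>. norm (x $ \<xi>) \<le> B"
  shows "norm x \<le> 6 * B"
proof -
  have "norm x \<le> (\<Sum>\<xi>\<in>UNIV. norm (x $ \<xi>))"
    unfolding norm_vec_def by (rule L2_set_le_sum) simp
  also have "\<dots> \<le> (\<Sum>\<xi>\<in>(UNIV :: 6 set). B)"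
    by (rule sum_mono) (rule assms)
  finally show ?thesis by simp
qed

definition sd_weight :: "real \<times> real \<Rightarrow> real" where
  "sd_weight \<omega> = (\<Sum>\<xi>\<in>UNIV. \<Sum>\<zeta>\<in>sd_stencil. \<Sum>\<xi>'\<in>UNIV. norm (sd_L \<omega> \<zeta> $ \<xi> $ \<xi>'))"

lemma sd_weight_nonneg: "0 \<le> sd_weight \<omega>"
  unfolding sd_weight_def by (intro sum_nonneg) auto

lemma sd_weight_bound:
  assumes "\<And>\<zeta> \<xi>'. \<zeta> \<in> sd_stencil \<Longrightarrow> norm (r \<zeta> \<xi>') \<le> \<rho>"
  shows "norm (\<Sum>\<zeta>\<in>sd_stencil. \<Sum>\<xi>'\<in>UNIV. sd_L \<omega> \<zeta> $ \<xi> $ \<xi>' * r \<zeta> \<xi>') \<le> sd_weight \<omega> * \<rho>"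
proof -
  have "(0, 0) \<in> sd_stencil"
    by (simp add: sd_stencil_def)
  then have \<rho>: "0 \<le> \<rho>"
    using assms norm_ge_zero order_trans by blast
  have "norm (\<Sum>\<zeta>\<in>sd_stencil. \<Sum>\<xi>'\<in>UNIV. sd_L \<omega> \<zeta> $ \<xi> $ \<xi>' * r \<zeta> \<xi>')
      \<le> (\<Sum>\<zeta>\<in>sd_stencil. \<Sum>\<xi>'\<in>UNIV. norm (sd_L \<omega> \<zeta> $ \<xi> $ \<xi>') * \<rho>)"
    by (intro sum_norm_le) (auto simp: norm_mult intro!: mult_left_mono assms)
  also have "\<dots> = (\<Sum>\<zeta>\<in>sd_stencil. \<Sum>\<xi>'\<in>UNIV. norm (sd_L \<omega> \<zeta> $ \<xi> $ \<xi>')) * \<rho>"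
    by (simp add: sum_distrib_right)
  also have "\<dots> \<le> sd_weight \<omega> * \<rho>"
    unfolding sd_weight_def
    by (intro mult_right_mono \<rho> member_le_sum[of \<xi> UNIV "\<lambda>\<xi>. \<Sum>\<zeta>\<in>sd_stencil. \<Sum>\<xi>'\<in>UNIV. norm (sd_L \<omega> \<zeta> $ \<xi> $ \<xi>')"])
       (auto intro!: sum_nonneg)
  finally show ?thesis .
qed

lemma C_k_2D:
  assumes "C_k 2 f"
  shows "f differentiable (at x)" "dirderiv a f differentiable (at x)"
    "continuous_on UNIV (dirderiv b (dirderiv a f))"
  using assms unfolding numeral_2_eq_2 C_k_Suc_iff C_k.simps(1) by (auto simp del: split_paired_All)

lemma C_k_3D:
  assumes "C_k 3 f"
  shows "f differentiable (at x)" "dirderiv a f differentiable (at x)"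
    "dirderiv b (dirderiv a f) differentiable (at x)"
    "continuous_on UNIV (dirderiv c (dirderiv b (dirderiv a f)))" "C_k 2 f"
proof -
  show "f differentiable (at x)" "dirderiv a f differentiable (at x)"
    "dirderiv b (dirderiv a f) differentiable (at x)"
    "continuous_on UNIV (dirderiv c (dirderiv b (dirderiv a f)))"
    using assms unfolding numeral_3_eq_3 C_k_Suc_iff C_k.simps(1) by (auto simp del: split_paired_All)
  show "C_k 2 f"
    by (rule C_k_SucD) (use assms in \<open>simp only: numeral_3_eq_3 numeral_2_eq_2\<close>)
qed

lemma sd_L_affine:
  assumes "\<And>x. v differentiable (at x)"
  shows "(\<Sum>\<zeta>\<in>sd_stencil. \<Sum>\<xi>'\<in>UNIV. sd_L \<omega> \<zeta> $ \<xi> $ \<xi>' *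
      (v x + h *\<^sub>R dirderiv (node \<zeta> \<xi>') v x)) = h *\<^sub>R dirderiv \<omega> v x"
proof -
  have split: "sd_L \<omega> \<zeta> $ \<xi> $ \<xi>' * (v x + h *\<^sub>R dirderiv (node \<zeta> \<xi>') v x) =
      sd_L \<omega> \<zeta> $ \<xi> $ \<xi>' * v x + of_real h * (sd_L \<omega> \<zeta> $ \<xi> $ \<xi>' *
        (of_real (fst (node \<zeta> \<xi>')) * dirderiv (1, 0) v x + of_real (snd (node \<zeta> \<xi>')) * dirderiv (0, 1) v x))"
    for \<zeta> \<xi>'
    unfolding dirderiv_coords[OF assms, of "node \<zeta> \<xi>'"] by (simp add: scaleR_conv_of_real algebra_simps)
  show ?thesis
    unfolding split sum.distrib sum_distrib_left[symmetric] sd_L_linear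
      sum_distrib_right[symmetric] sd_L_sum dirderiv_coords[OF assms, of \<omega>]
    by (simp add: scaleR_conv_of_real)
qed

text \<open>
  The affine Taylor polynomial of \<open>v\<close> has residual 0.  Its remainder \<open>O(h\<^sup>2)\<close> is divided by \<open>h\<close> in the
  difference term.
\<close>

lemma sd_residual_order1:
  assumes per: "periodic1 v" and C: "C_k 2 v"
  obtains K where "0 \<le> K" "\<forall>N>0. \<forall>x. norm (sd_residual \<omega> N v x) \<le> K * (1 / real N)"
proof -
  note d = C_k_2D[OF C]
  define B where "B = (\<lambda>(\<zeta>, \<xi>). node \<zeta> \<xi>) ` (sd_stencil \<times> UNIV)"
  have fin: "finite (B \<times> insert \<omega> B)"
    unfolding B_def sd_stencil_def by simp
  have "\<exists>M. 0 \<le> M \<and> (\<forall>(b,a)\<in>B \<times> insert \<omega> B. \<forall>x. norm (dirderiv b (dirderiv a v) x) \<le> M)"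
    using periodic1_family_bounded[OF fin, of "\<lambda>(b,a). dirderiv b (dirderiv a v)"]
      periodic1_dirderiv[OF periodic1_dirderiv[OF per d(1)] d(2)] d(3)
    by (auto split: prod.splits)
  then obtain M where M0: "0 \<le> M"
    and M: "\<And>b a x. b \<in> B \<Longrightarrow> a \<in> insert \<omega> B \<Longrightarrow> norm (dirderiv b (dirderiv a v) x) \<le> M"
    by fastforce
  have B: "node \<zeta> \<xi> \<in> B" if "\<zeta> \<in> sd_stencil" for \<zeta> \<xi>
    unfolding B_def using that by force
  have B0: "node (0, 0) \<xi> \<in> B" for \<xi>
    by (rule B) (simp add: sd_stencil_def)
  show ?thesis
  proof (rule that[of "6 * (sd_weight \<omega> * M + M)"]; (intro allI impI)?)
    show "0 \<le> 6 * (sd_weight \<omega> * M + M)"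
      using M0 sd_weight_nonneg by simp
    fix N :: nat and x assume N: "N > 0"
    define h where "h = 1 / real N"
    have h: "h > 0" "real N * h = 1"
      using N by (simp_all add: h_def)
    define r where "r \<zeta> \<xi> = v (x + h *\<^sub>R node \<zeta> \<xi>) - v x - h *\<^sub>R dirderiv (node \<zeta> \<xi>) v x" for \<zeta> \<xi>
    have r: "norm (r \<zeta> \<xi>) \<le> M * h\<^sup>2" if "\<zeta> \<in> sd_stencil" for \<zeta> \<xi>
      unfolding r_def by (rule Taylor_order2) (use d(1,2) M B[OF that] h in auto)
    have "norm (sd_residual \<omega> N v x $ \<xi>) \<le> (sd_weight \<omega> * M + M) * h" for \<xi>
    proof -
      define \<rho> where "\<rho> = (\<Sum>\<zeta>\<in>sd_stencil. \<Sum>\<xi>'\<in>UNIV. sd_L \<omega> \<zeta> $ \<xi> $ \<xi>' * r \<zeta> \<xi>')"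
      define s where "s = dirderiv \<omega> v (x + h *\<^sub>R node (0, 0) \<xi>) - dirderiv \<omega> v x"
      have \<rho>: "norm \<rho> \<le> sd_weight \<omega> * (M * h\<^sup>2)"
        unfolding \<rho>_def by (rule sd_weight_bound) (rule r)
      have s: "norm s \<le> M * h"
        unfolding s_def by (rule Taylor_order1) (use d(2) M B0 h in auto)
      have "v (x + h *\<^sub>R node \<zeta> \<xi>') = (v x + h *\<^sub>R dirderiv (node \<zeta> \<xi>') v x) + r \<zeta> \<xi>'" for \<zeta> \<xi>'
        by (simp add: r_def)
      then have "(\<Sum>\<zeta>\<in>sd_stencil. \<Sum>\<xi>'\<in>UNIV. sd_L \<omega> \<zeta> $ \<xi> $ \<xi>' * v (x + h *\<^sub>R node \<zeta> \<xi>'))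
          = h *\<^sub>R dirderiv \<omega> v x + \<rho>"
        by (simp only: distrib_left[of "sd_L \<omega> _ $ _ $ _"] sum.distrib
            sd_L_affine[OF d(1), unfolded distrib_left sum.distrib] \<rho>_def)
      then have "sd_residual \<omega> N v x $ \<xi> = real N *\<^sub>R \<rho> - s"
        unfolding sd_residual_def h_def[symmetric] s_def by (simp add: scaleR_add_right h)
      also have "norm \<dots> \<le> real N * norm \<rho> + norm s"
        using norm_triangle_ineq4[of "real N *\<^sub>R \<rho>" s] by simp
      also have "\<dots> \<le> real N * (sd_weight \<omega> * (M * h\<^sup>2)) + M * h"
        using \<rho> s by (intro add_mono mult_left_mono) auto
      also have "\<dots> = (sd_weight \<omega> * M) * (real N * h) * h + M * h"
        by (simp add: power2_eq_square)
      finally show ?thesis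
        by (simp only: h(2) mult_1_right distrib_right)
    qed
    from norm_vec6_le[OF this]
    show "norm (sd_residual \<omega> N v x) \<le> 6 * (sd_weight \<omega> * M + M) * (1 / real N)"
      unfolding h_def by (simp only: mult.assoc)
  qed
qed

text \<open>
  The quadratic Taylor polynomial of \<open>v\<close> contributes \<open>h\<close> times its residual on the unit mesh, and the
  remainder \<open>O(h\<^sup>3)\<close> contributes \<open>O(h\<^sup>2)\<close>.
\<close>

lemma sd_residual_order2:
  assumes per: "periodic1 v" and C: "C_k 3 v"
  obtains K where "0 \<le> K" "\<forall>N>0. \<forall>x. norm (sd_residual \<omega> N v x
     - (1 / real N) *\<^sub>R quadratic_residual \<omega> (dirderiv (1, 0) (dirderiv (1, 0) v) x)
         (dirderiv (1, 0) (dirderiv (0, 1) v) x) (dirderiv (0, 1) (dirderiv (0, 1) v) x))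
     \<le> K * (1 / real N)\<^sup>2"
proof -
  note d = C_k_3D[OF C]
  define B where "B = (\<lambda>(\<zeta>, \<xi>). node \<zeta> \<xi>) ` (sd_stencil \<times> UNIV)"
  have fin: "finite (B \<times> B \<times> insert \<omega> B)"
    unfolding B_def sd_stencil_def by simp
  have "\<exists>M. 0 \<le> M \<and> (\<forall>(c,b,a)\<in>B \<times> B \<times> insert \<omega> B. \<forall>x. norm (dirderiv c (dirderiv b (dirderiv a v)) x) \<le> M)"
    using periodic1_family_bounded[OF fin, of "\<lambda>(c,b,a). dirderiv c (dirderiv b (dirderiv a v))"]
      periodic1_dirderiv[OF periodic1_dirderiv[OF periodic1_dirderiv[OF per d(1)] d(2)] d(3)] d(4)
    by (auto split: prod.splits)
  then obtain M where M0: "0 \<le> M" and M: "\<And>c b a x. c \<in> B \<Longrightarrow> b \<in> B \<Longrightarrow> a \<in> insert \<omega> B \<Longrightarrow>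
      norm (dirderiv c (dirderiv b (dirderiv a v)) x) \<le> M"
    by fastforce
  have B: "node \<zeta> \<xi> \<in> B" if "\<zeta> \<in> sd_stencil" for \<zeta> \<xi>
    unfolding B_def using that by force
  have B0: "node (0, 0) \<xi> \<in> B" for \<xi>
    by (rule B) (simp add: sd_stencil_def)
  show ?thesis
  proof (rule that[of "6 * (sd_weight \<omega> * M + M)"]; (intro allI impI)?)
    show "0 \<le> 6 * (sd_weight \<omega> * M + M)"
      using M0 sd_weight_nonneg by simp
    fix N :: nat and x assume N: "N > 0"
    define h where "h = 1 / real N"
    have h: "h > 0" "real N * h = 1"
      using N by (simp_all add: h_def)
    define p where "p = dirderiv (1, 0) (dirderiv (1, 0) v) x"
    define q where "q = dirderiv (0, 1) (dirderiv (0, 1) v) x"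
    define m where "m = dirderiv (1, 0) (dirderiv (0, 1) v) x"
    have m': "dirderiv (0, 1) (dirderiv (1, 0) v) x = m"
      unfolding m_def by (rule dirderiv_commute[OF per C])
    have second: "dirderiv a (dirderiv b v) x = of_real (fst a * fst b) * p
        + of_real (fst a * snd b + snd a * fst b) * m + of_real (snd a * snd b) * q" for a b
      unfolding dirderiv2_coords[OF d(5), of a b] m' m_def[symmetric] p_def[symmetric] q_def[symmetric]
      by (simp add: scaleR_conv_of_real algebra_simps)
    define r where "r \<zeta> \<xi> = v (x + h *\<^sub>R node \<zeta> \<xi>) - v x - h *\<^sub>R dirderiv (node \<zeta> \<xi>) v x
      - (h\<^sup>2 / 2) *\<^sub>R dirderiv (node \<zeta> \<xi>) (dirderiv (node \<zeta> \<xi>) v) x" for \<zeta> \<xi>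
    have r: "norm (r \<zeta> \<xi>) \<le> M * h ^ 3" if "\<zeta> \<in> sd_stencil" for \<zeta> \<xi>
      unfolding r_def by (rule Taylor_order3) (use d(1-3) M B[OF that] h in auto)
    have "norm ((sd_residual \<omega> N v x - h *\<^sub>R quadratic_residual \<omega> p m q) $ \<xi>)
        \<le> (sd_weight \<omega> * M + M) * h\<^sup>2" for \<xi>
    proof -
      define \<rho> where "\<rho> = (\<Sum>\<zeta>\<in>sd_stencil. \<Sum>\<xi>'\<in>UNIV. sd_L \<omega> \<zeta> $ \<xi> $ \<xi>' * r \<zeta> \<xi>')"
      define a where "a = node (0, 0) \<xi>"
      define s where "s = dirderiv \<omega> v (x + h *\<^sub>R a) - dirderiv \<omega> v x
        - h *\<^sub>R dirderiv a (dirderiv \<omega> v) x"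
      have \<rho>: "norm \<rho> \<le> sd_weight \<omega> * (M * h ^ 3)"
        unfolding \<rho>_def by (rule sd_weight_bound) (rule r)
      have s: "norm s \<le> M * h\<^sup>2"
        unfolding s_def a_def by (rule Taylor_order2) (use d(2,3) M B0 h in auto)
      define w where "w b = (of_real (fst b))\<^sup>2 * p + 2 * of_real (fst b) * of_real (snd b) * m
          + (of_real (snd b))\<^sup>2 * q" for b
      have "dirderiv b (dirderiv b v) x = w b" for b
        unfolding second w_def by (simp add: power2_eq_square)
      then have "v (x + h *\<^sub>R node \<zeta> \<xi>') = (v x + h *\<^sub>R dirderiv (node \<zeta> \<xi>') v x)
          + (of_real (h\<^sup>2 / 2) * w (node \<zeta> \<xi>') + r \<zeta> \<xi>')" for \<zeta> \<xi>'
        by (simp add: r_def scaleR_conv_of_real)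
      then have "(\<Sum>\<zeta>\<in>sd_stencil. \<Sum>\<xi>'\<in>UNIV. sd_L \<omega> \<zeta> $ \<xi> $ \<xi>' * v (x + h *\<^sub>R node \<zeta> \<xi>'))
          = h *\<^sub>R dirderiv \<omega> v x + (of_real (h\<^sup>2 / 2) *
             (\<Sum>\<zeta>\<in>sd_stencil. \<Sum>\<xi>'\<in>UNIV. sd_L \<omega> \<zeta> $ \<xi> $ \<xi>' * w (node \<zeta> \<xi>')) + \<rho>)"
        by (simp only: distrib_left[of "sd_L \<omega> _ $ _ $ _"] sum.distrib
            sd_L_affine[OF d(1), unfolded distrib_left sum.distrib] \<rho>_def
            mult.left_commute[of "sd_L \<omega> _ $ _ $ _" "of_real (h\<^sup>2 / 2)"] sum_distrib_left)
      also have "of_real (h\<^sup>2 / 2) * (\<Sum>\<zeta>\<in>sd_stencil. \<Sum>\<xi>'\<in>UNIV. sd_L \<omega> \<zeta> $ \<xi> $ \<xi>' * w (node \<zeta> \<xi>'))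
          = h\<^sup>2 *\<^sub>R (dirderiv a (dirderiv \<omega> v) x + quadratic_residual \<omega> p m q $ \<xi>)"
        using sd_L_quadratic[of \<omega> \<xi> p m q]
        unfolding w_def[symmetric] a_def[symmetric] second
        by (simp add: scaleR_conv_of_real)
      finally have "sd_residual \<omega> N v x $ \<xi> = real N *\<^sub>R \<rho> - s + h *\<^sub>R quadratic_residual \<omega> p m q $ \<xi>"
        unfolding sd_residual_def h_def[symmetric] s_def a_def
        by (simp add: scaleR_add_right h power2_eq_square mult.assoc[symmetric])
      then have "(sd_residual \<omega> N v x - h *\<^sub>R quadratic_residual \<omega> p m q) $ \<xi> = real N *\<^sub>R \<rho> - s"
        by simp
      also have "norm \<dots> \<le> real N * norm \<rho> + norm s"
        using norm_triangle_ineq4[of "real N *\<^sub>R \<rho>" s] by simp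
      also have "\<dots> \<le> real N * (sd_weight \<omega> * (M * h ^ 3)) + M * h\<^sup>2"
        using \<rho> s by (intro add_mono mult_left_mono) auto
      also have "\<dots> = (sd_weight \<omega> * M) * (real N * h) * h\<^sup>2 + M * h\<^sup>2"
        by (simp add: power2_eq_square power3_eq_cube)
      finally show ?thesis
        by (simp only: h(2) mult_1_right distrib_right)
    qed
    from norm_vec6_le[OF this]
    show "norm (sd_residual \<omega> N v x - (1 / real N) *\<^sub>R quadratic_residual \<omega>
        (dirderiv (1, 0) (dirderiv (1, 0) v) x) (dirderiv (1, 0) (dirderiv (0, 1) v) x)
        (dirderiv (0, 1) (dirderiv (0, 1) v) x)) \<le> 6 * (sd_weight \<omega> * M + M) * (1 / real N)\<^sup>2"
      unfolding h_def p_def q_def m_def by (simp only: mult.assoc)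
  qed
qed

section \<open>The error equation and the order from below\<close>

lemma has_vector_derivative_vec:
  fixes f :: "real \<Rightarrow> complex^'n"
  assumes "\<And>i. ((\<lambda>s. f s $ i) has_vector_derivative d $ i) (at t within S)"
  shows "(f has_vector_derivative d) (at t within S)"
proof -
  have "((\<lambda>y. (f y - (f t + (y - t) *\<^sub>R d)) /\<^sub>R norm (y - t)) \<longlongrightarrow> 0) (at t within S)"
    by (rule vec_tendstoI)
       (use assms in \<open>simp add: has_vector_derivative_def has_derivative_at_within diff_diff_eq\<close>)
  then show ?thesis
    by (simp add: has_vector_derivative_def has_derivative_at_within bounded_linear_scaleR_left diff_diff_eq)
qed

definition block_point :: "nat \<Rightarrow> int \<times> int \<Rightarrow> real \<times> real" where
  "block_point N \<eta> = (1 / real N) *\<^sub>R (of_int (fst \<eta>), of_int (snd \<eta>))"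

lemma block_point_add: "block_point N (\<eta> + \<zeta>) = block_point N \<eta> + (1 / real N) *\<^sub>R (of_int (fst \<zeta>), of_int (snd \<zeta>))"
  by (simp add: block_point_def prod_eq_iff add_divide_distrib)

lemma sd_lagrange_exact:
  "sd_lagrange N (exact_solution \<omega> v t) (\<eta> + \<zeta>) $ \<xi>
   = v ((block_point N \<eta> - t *\<^sub>R \<omega>) + (1 / real N) *\<^sub>R node \<zeta> \<xi>)"
  by (simp add: sd_lagrange_def exact_solution_def block_point_def node_def)
     (rule arg_cong[where f = v], simp add: prod_eq_iff add_divide_distrib)

lemma sd_lagrange_derivative:
  assumes d: "\<And>x. v differentiable (at x)"
  shows "((\<lambda>s. sd_lagrange N (exact_solution \<omega> v s) \<eta>) has_vector_derivative
     (\<chi> \<xi>. - dirderiv \<omega> v ((block_point N \<eta> - t *\<^sub>R \<omega>) + (1 / real N) *\<^sub>R node (0, 0) \<xi>))) (at t within S)"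
proof (rule has_vector_derivative_vec)
  fix \<xi>
  let ?x = "block_point N \<eta> + (1 / real N) *\<^sub>R node (0, 0) \<xi>"
  have "sd_lagrange N (exact_solution \<omega> v s) \<eta> $ \<xi> = v (?x + s *\<^sub>R (- \<omega>))" for s
    using sd_lagrange_exact[of N \<omega> v s \<eta> "(0, 0)" \<xi>]
    by (simp add: algebra_simps flip: zero_prod_def)
  moreover have "dirderiv (- \<omega>) v (?x + t *\<^sub>R (- \<omega>)) = - dirderiv \<omega> v (?x + t *\<^sub>R (- \<omega>))"
    using dirderiv_scaleR[OF d, of "-1" \<omega>] by simp
  ultimately show "((\<lambda>s. sd_lagrange N (exact_solution \<omega> v s) \<eta> $ \<xi>) has_vector_derivative
     (\<chi> \<xi>. - dirderiv \<omega> v ((block_point N \<eta> - t *\<^sub>R \<omega>) + (1 / real N) *\<^sub>R node (0, 0) \<xi>)) $ \<xi>) (at t within S)"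
    using dirderiv_along_line[OF d, of ?x "- \<omega>" t S] by (simp add: algebra_simps)
qed

lemma sd_op_diff: "sd_op \<omega> (\<lambda>\<eta>. u \<eta> - w \<eta>) \<eta> = sd_op \<omega> u \<eta> - sd_op \<omega> w \<eta>"
  by (simp add: sd_op_def matrix_vector_mult_diff_distrib sum_subtractf)

lemma sd_op_nth: "sd_op \<omega> w \<eta> $ \<xi> = (\<Sum>\<zeta>\<in>sd_stencil. \<Sum>\<xi>'\<in>UNIV. sd_L \<omega> \<zeta> $ \<xi> $ \<xi>' * w (\<eta> + \<zeta>) $ \<xi>')"
  by (simp add: sd_op_def matrix_vector_mult_def)

lemma sd_error_derivative:
  assumes sol: "sd_solution \<omega> N v u" and d: "\<And>x. v differentiable (at x)" and t: "t \<ge> 0"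
  shows "((\<lambda>s. sd_error \<omega> N v u s \<eta>) has_vector_derivative
     - (real N *\<^sub>R sd_op \<omega> (sd_error \<omega> N v u t) \<eta>) - sd_residual \<omega> N v (block_point N \<eta> - t *\<^sub>R \<omega>))
     (at t within {0..})"
proof -
  let ?\<Pi> = "sd_lagrange N (exact_solution \<omega> v t)"
  let ?d = "\<chi> \<xi>. - dirderiv \<omega> v ((block_point N \<eta> - t *\<^sub>R \<omega>) + (1 / real N) *\<^sub>R node (0, 0) \<xi>)"
  have "sd_residual \<omega> N v (block_point N \<eta> - t *\<^sub>R \<omega>) = real N *\<^sub>R sd_op \<omega> ?\<Pi> \<eta> + ?d"
    by (simp add: vec_eq_iff sd_residual_def sd_op_nth sd_lagrange_exact)
  moreover have "sd_op \<omega> (sd_error \<omega> N v u t) \<eta> = sd_op \<omega> (u t) \<eta> - sd_op \<omega> ?\<Pi> \<eta>"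
    unfolding sd_error_def[abs_def] by (rule sd_op_diff)
  ultimately have eq: "- (real N *\<^sub>R sd_op \<omega> (u t) \<eta>) - ?d = - (real N *\<^sub>R sd_op \<omega> (sd_error \<omega> N v u t) \<eta>)
      - sd_residual \<omega> N v (block_point N \<eta> - t *\<^sub>R \<omega>)"
    by (simp add: scaleR_diff_right)
  have "((\<lambda>s. u s \<eta>) has_vector_derivative - (real N *\<^sub>R sd_op \<omega> (u t) \<eta>)) (at t within {0..})"
    using sol t unfolding sd_solution_def sd_op_def by blast
  then have "((\<lambda>s. u s \<eta> - sd_lagrange N (exact_solution \<omega> v s) \<eta>) has_vector_derivative
      - (real N *\<^sub>R sd_op \<omega> (u t) \<eta>) - ?d) (at t within {0..})"
    by (rule has_vector_derivative_diff[OF _ sd_lagrange_derivative[OF d]])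
  then show ?thesis
    unfolding eq sd_error_def .
qed

lemma mesh_periodic_shift:
  assumes "periodic1 g" "N > 0"
  shows "g ((block_point N (i + int N, j) - x) + y) = g ((block_point N (i, j) - x) + y)"
    and "g ((block_point N (i, j + int N) - x) + y) = g ((block_point N (i, j) - x) + y)"
proof -
  define r where "r = (block_point N (i, j) - x) + y"
  have "(block_point N (i + int N, j) - x) + y = (fst r + 1, snd r)"
    "(block_point N (i, j + int N) - x) + y = (fst r, snd r + 1)"
    using assms(2) by (simp_all add: r_def block_point_def prod_eq_iff add_divide_distrib)
  then have "g ((block_point N (i + int N, j) - x) + y) = g r" "g ((block_point N (i, j + int N) - x) + y) = g r"
    using assms(1) unfolding periodic1_def by simp_all
  then show "g ((block_point N (i + int N, j) - x) + y) = g ((block_point N (i, j) - x) + y)"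
    "g ((block_point N (i, j + int N) - x) + y) = g ((block_point N (i, j) - x) + y)"
    unfolding r_def by simp_all
qed

lemma mesh_periodic_sd_error:
  assumes sol: "sd_solution \<omega> N v u" and per: "periodic1 v" and "N > 0" "t \<ge> 0"
  shows "mesh_periodic N (sd_error \<omega> N v u t)"
proof -
  have "sd_lagrange N (exact_solution \<omega> v t) (i + int N, j) = sd_lagrange N (exact_solution \<omega> v t) (i, j)"
    "sd_lagrange N (exact_solution \<omega> v t) (i, j + int N) = sd_lagrange N (exact_solution \<omega> v t) (i, j)" for i j
    using sd_lagrange_exact[of N \<omega> v t _ "(0, 0)"] mesh_periodic_shift[OF per \<open>N > 0\<close>]
    by (simp_all add: vec_eq_iff flip: zero_prod_def)
  moreover have "mesh_periodic N (u t)"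
    using sol \<open>t \<ge> 0\<close> by (simp add: sd_solution_def)
  ultimately show ?thesis
    by (simp add: mesh_periodic_def sd_error_def)
qed

lemma sd_error_initial: "sd_solution \<omega> N v u \<Longrightarrow> sd_error \<omega> N v u 0 \<eta> = 0"
  by (simp add: sd_error_def sd_solution_def exact_solution_def[abs_def] del: split_paired_All)

text \<open>
  Stability needs a positive bound for the initial error, which vanishes here; \<open>h\<close> serves as such a bound.
\<close>

theorem sd_has_order_1:
  assumes "fst \<omega> \<ge> 0" "snd \<omega> \<ge> 0"
  shows "sd_has_order \<omega> 1"
  unfolding sd_has_order_def
proof (intro allI impI)
  fix v assume v: "periodic1 v \<and> C_k (1 + 1) v"
  then have per: "periodic1 v" and C: "C_k 2 v"
    by (simp_all only: one_add_one)
  obtain K where K: "0 \<le> K" "\<forall>N>0. \<forall>x. norm (sd_residual \<omega> N v x) \<le> K * (1 / real N)"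
    by (rule sd_residual_order1[OF per C, of \<omega>])
  show "\<exists>c1 c2 :: real. \<forall>N>0. \<forall>u. sd_solution \<omega> N v u \<longrightarrow>
         (\<forall>t\<ge>0. mesh_norm N (sd_error \<omega> N v u t) \<le> (c1 + c2 * t) * (1 / real N) ^ 1)"
  proof (rule exI[of _ 7], rule exI[of _ "7 * (K + 1)"], intro allI impI)
    fix N :: nat and u and t :: real
    assume N: "N > 0" and sol: "sd_solution \<omega> N v u" and t: "t \<ge> 0"
    define h where "h = 1 / real N"
    have h: "h > 0" using N by (simp add: h_def)
    have "mesh_norm N (sd_error \<omega> N v u t) \<le> 7 * (h + (K + 1) * h * t)"
    proof (rule sd_stability[where \<tau> = "\<lambda>s \<eta>. sd_residual \<omega> N v (block_point N \<eta> - s *\<^sub>R \<omega>)",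
          OF N assms _ sd_error_derivative[OF sol C_k_2D(1)[OF C]] _ _ _ _ t])
      show "mesh_periodic N (sd_error \<omega> N v u s)" if "s \<ge> 0" for s
        by (rule mesh_periodic_sd_error[OF sol per N that])
      show "norm (sd_error \<omega> N v u 0 \<eta>) \<le> h" for \<eta>
        using h by (simp add: sd_error_initial[OF sol])
      show "norm (sd_residual \<omega> N v (block_point N \<eta> - s *\<^sub>R \<omega>)) \<le> (K + 1) * h" for s \<eta>
        using K(2)[rule_format, OF N, of "block_point N \<eta> - s *\<^sub>R \<omega>"] h unfolding h_def[symmetric]
        by (simp add: distrib_right)
    qed (use h K(1) in auto)
    then show "mesh_norm N (sd_error \<omega> N v u t) \<le> (7 + 7 * (K + 1) * t) * (1 / real N) ^ 1"
      unfolding h_def[symmetric] by (simp add: algebra_simps)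
  qed
qed

text \<open>
  The matrix \<open>\<Sum>\<^sub>\<zeta> L\<^sub>\<zeta>\<close> is singular because it annihilates constants, but for positive
  velocity components the residual of a quadratic polynomial is in its range.  The vectors below solve the system for \<open>v\<^sub>x\<^sub>x\<close>, \<open>v\<^sub>x\<^sub>y\<close> and \<open>v\<^sub>y\<^sub>y\<close> with last component
  normalised to 0.  Their common denominator \<open>108 X Y (X + Y)\<close> vanishes when a velocity component does;
  that is the case in which the order drops.
\<close>

lemma correction_exists:
  assumes "fst \<omega> > 0" "snd \<omega> > 0"
  shows "\<exists>A B D :: complex^6. \<forall>p r q. (\<Sum>\<zeta>\<in>sd_stencil. sd_L \<omega> \<zeta> *v (p *s A + r *s B + q *s D))
      = - quadratic_residual \<omega> p r q"
proof -
  define X Y :: complex where "X = of_real (fst \<omega>)" and "Y = of_real (snd \<omega>)"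
  have nz: "X \<noteq> 0" "Y \<noteq> 0" "X + Y \<noteq> 0"
    using assms unfolding X_def Y_def by (simp_all flip: of_real_add)
  define c where "c = 1 / (108 * X * Y * (X + Y))"
  have c: "108 * (c * (X * (Y * (X + Y)))) = 1"
    using nz by (simp add: c_def)
  define A :: "complex^6" where "A = c *s vector
    [- (14 * X + 22 * Y) * X * Y, - 12 * X * X * Y, - (2 * X\<^sup>2 + 22 * Y\<^sup>2) * X,
     - (2 * X + 22 * Y) * X * (X + Y), (8 * X * Y - 2 * X\<^sup>2) * X, 0]"
  define B :: "complex^6" where "B = c *s vector
    [- (8 * X + 4 * Y) * Y * (X + Y), (24 * X - 12 * Y) * X * Y, 4 * X^3 - 8 * X\<^sup>2 * Y + 20 * X * Y\<^sup>2 - 4 * Y^3,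
     (4 * X\<^sup>2 - 4 * Y\<^sup>2) * (X + Y), (4 * X - 28 * Y) * X * (X + Y), 0]"
  define D :: "complex^6" where "D = c *s vector
    [(10 * X * Y + 2 * Y\<^sup>2) * Y, 24 * X * Y * Y, (22 * X\<^sup>2 + 12 * X * Y + 2 * Y\<^sup>2) * Y,
     (22 * X + 2 * Y) * Y * (X + Y), (22 * X + 32 * Y) * X * Y, 0]"
  have "\<forall>\<xi>. (\<Sum>\<zeta>\<in>sd_stencil. \<Sum>\<xi>'\<in>UNIV. sd_L \<omega> \<zeta> $ \<xi> $ \<xi>' * (p *s A + r *s B + q *s D) $ \<xi>')
      = 108 * (c * (X * (Y * (X + Y)))) * - quadratic_residual \<omega> p r q $ \<xi>" for p r q
    unfolding forall_6 sum_stencil sum_6 sd_L_nth sd_Lx_def sd_Ly_def quadratic_residual_def Let_def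
      X_def[symmetric] Y_def[symmetric] A_def B_def D_def
    by (simp add: field_simps power2_eq_square power3_eq_cube)
  then have "(\<Sum>\<zeta>\<in>sd_stencil. sd_L \<omega> \<zeta> *v (p *s A + r *s B + q *s D)) = - quadratic_residual \<omega> p r q" for p r q
    unfolding c by (simp add: vec_eq_iff matrix_vector_mult_def)
  then show ?thesis by blast
qed

lemma has_derivative_dirderiv:
  "f differentiable (at x) \<Longrightarrow> (f has_derivative (\<lambda>b. dirderiv b f x)) (at x)"
  unfolding dirderiv_def by (rule iffD1[OF frechet_derivative_works])

lemma bounded_linear_vector_scalar: "bounded_linear (\<lambda>p. p *s (A :: complex^6))"
proof (rule bounded_linear_intro[where K = "6 * norm A"])
  fix p :: complex
  have "norm ((p *s A) $ \<xi>) \<le> norm p * norm A" for \<xi>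
    by (simp add: norm_mult mult_left_mono Finite_Cartesian_Product.norm_nth_le)
  from norm_vec6_le[OF this] show "norm (p *s A) \<le> norm p * (6 * norm A)"
    by (simp add: algebra_simps)
qed (simp_all add: vec_eq_iff algebra_simps)

lemma mesh_norm_perturbation:
  assumes N: "N > 0" and K: "\<And>\<eta>. norm (f \<eta> - g \<eta>) \<le> K"
  shows "mesh_norm N f \<le> mesh_norm N g + K"
proof -
  define B where "B = {1..int N} \<times> {1..int N}"
  define h where "h = 1 / real N"
  have h: "h > 0" "h\<^sup>2 * real (card B) = 1"
    using N by (simp_all add: h_def B_def card_cartesian_product power2_eq_square)
  have L2: "mesh_norm N f = L2_set (\<lambda>\<eta>. h * norm (f \<eta>)) B" for f
    by (simp add: mesh_norm_def L2_set_def B_def h_def power_mult_distrib power_divide)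
  have K0: "0 \<le> K"
    using K norm_ge_zero order_trans by blast
  have "norm (f \<eta>) \<le> norm (g \<eta>) + K" for \<eta>
    using K[of \<eta>] norm_triangle_ineq2[of "f \<eta>" "g \<eta>"] by linarith
  then have "h * norm (f \<eta>) \<le> h * norm (g \<eta>) + h * K" for \<eta>
    using h(1) by (metis distrib_left less_eq_real_def mult_left_mono)
  then have "mesh_norm N f \<le> L2_set (\<lambda>\<eta>. h * norm (g \<eta>) + h * K) B"
    unfolding L2 using h(1) by (intro L2_set_mono) auto
  also have "\<dots> \<le> mesh_norm N g + L2_set (\<lambda>\<eta>. h * K) B"
    unfolding L2 by (rule L2_set_triangle_ineq)
  also have "L2_set (\<lambda>\<eta>. h * K) B = sqrt ((h\<^sup>2 * real (card B)) * K\<^sup>2)"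
    by (simp add: L2_set_def power_mult_distrib mult.assoc mult.left_commute)
  also have "\<dots> = K"
    unfolding h(2) using K0 by simp
  finally show ?thesis .
qed

text \<open>
  Subtracting \<open>h\<^sup>2 c\<close> from the error removes the leading part of the residual.  What remains are
  differences of \<open>c\<close> between neighbouring blocks and the time derivative of \<open>h\<^sup>2 c\<close>; both need one derivative of
  \<open>c\<close>, hence the third derivatives of the data.
\<close>

theorem sd_has_order_2:
  assumes \<omega>: "fst \<omega> > 0" "snd \<omega> > 0"
  shows "sd_has_order \<omega> 2"
  unfolding sd_has_order_def
proof (intro allI impI)
  fix v assume v: "periodic1 v \<and> C_k (2 + 1) v"
  moreover have "(2::nat) + 1 = 3" by simp
  ultimately have per: "periodic1 v" and C: "C_k 3 v"
    by (simp_all only:)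
  note d = C_k_3D[OF C]
  let ?p = "dirderiv (1, 0) (dirderiv (1, 0) v)" and ?r = "dirderiv (1, 0) (dirderiv (0, 1) v)"
    and ?q = "dirderiv (0, 1) (dirderiv (0, 1) v)"
  obtain K where K: "0 \<le> K" "\<forall>N>0. \<forall>x.
      norm (sd_residual \<omega> N v x - (1 / real N) *\<^sub>R quadratic_residual \<omega> (?p x) (?r x) (?q x)) \<le> K * (1 / real N)\<^sup>2"
    by (rule sd_residual_order2[OF per C, of \<omega>])
  obtain A B D :: "complex^6" where corr:
    "\<And>p r q. (\<Sum>\<zeta>\<in>sd_stencil. sd_L \<omega> \<zeta> *v (p *s A + r *s B + q *s D)) = - quadratic_residual \<omega> p r q"
    using correction_exists[OF \<omega>] by blast
  define F where "F p r q = p *s A + r *s B + q *s D" for p r q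
  define kF where "kF = 6 * (norm A + norm B + norm D)"
  have F_bound: "norm (F p r q) \<le> M * kF" if "norm p \<le> M" "norm r \<le> M" "norm q \<le> M" for p r q M
  proof -
    have "norm (p *s E) \<le> 6 * (M * norm E)" if "norm p \<le> M" for p and E :: "complex^6"
      by (rule norm_vec6_le)
         (auto simp: norm_mult intro!: mult_mono that Finite_Cartesian_Product.norm_nth_le
           order_trans[OF norm_ge_zero that])
    from this[of p A] this[of r B] this[of q D] that show ?thesis
      unfolding F_def kF_def
      using norm_triangle_ineq[of "p *s A + r *s B" "q *s D"] norm_triangle_ineq[of "p *s A" "r *s B"]
      by (simp add: algebra_simps)
  qed
  define c where "c x = F (?p x) (?r x) (?q x)" for x
  have per_c: "c (block_point N (i + int N, j) - x) = c (block_point N (i, j) - x)"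
    "c (block_point N (i, j + int N) - x) = c (block_point N (i, j) - x)" if "N > 0" for N i j x
    using mesh_periodic_shift[OF periodic1_dirderiv[OF periodic1_dirderiv[OF per d(1)] d(2)] that, where y = 0]
    by (simp_all add: c_def)
  have c_der: "(c has_derivative (\<lambda>b. F (dirderiv b ?p x) (dirderiv b ?r x) (dirderiv b ?q x))) (at x)" for x
    unfolding c_def F_def
    by (intro has_derivative_add bounded_linear.has_derivative[OF bounded_linear_vector_scalar]
        has_derivative_dirderiv d(3))
  have c_diff: "c differentiable (at x)" for x
    using c_der differentiable_def by blast
  have c_dir: "dirderiv b c x = F (dirderiv b ?p x) (dirderiv b ?r x) (dirderiv b ?q x)" for b x
    by (simp add: dirderiv_def[of _ c] flip: frechet_derivative_at[OF c_der])
  define S where "S = insert \<omega> ((\<lambda>\<zeta>. (real_of_int (fst \<zeta>), real_of_int (snd \<zeta>))) ` sd_stencil)"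
  define E where "E = {(1, 0), (0, 1) :: real \<times> real}"
  have S: "\<omega> \<in> S" "\<And>\<zeta>. \<zeta> \<in> sd_stencil \<Longrightarrow> (real_of_int (fst \<zeta>), real_of_int (snd \<zeta>)) \<in> S"
    by (auto simp: S_def)
  have E: "(1, 0) \<in> E" "(0, 1) \<in> E"
    by (simp_all add: E_def)
  have "\<exists>M. 0 \<le> M \<and> (\<forall>(b,a)\<in>E \<times> E. \<forall>x. norm (dirderiv b (dirderiv a v) x) \<le> M)"
    using periodic1_family_bounded[of "E \<times> E" "\<lambda>(b,a). dirderiv b (dirderiv a v)"]
      periodic1_dirderiv[OF periodic1_dirderiv[OF per d(1)] d(2)] C_k_2D(3)[OF d(5)]
    by (auto simp: E_def)
  then obtain M0 where M0: "0 \<le> M0"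
    and M0': "\<And>b a x. b \<in> E \<Longrightarrow> a \<in> E \<Longrightarrow> norm (dirderiv b (dirderiv a v) x) \<le> M0"
    by fastforce
  have "\<exists>M. 0 \<le> M \<and> (\<forall>(e,b,a)\<in>S \<times> E \<times> E. \<forall>x. norm (dirderiv e (dirderiv b (dirderiv a v)) x) \<le> M)"
    using periodic1_family_bounded[of "S \<times> E \<times> E" "\<lambda>(e,b,a). dirderiv e (dirderiv b (dirderiv a v))"]
      periodic1_dirderiv[OF periodic1_dirderiv[OF periodic1_dirderiv[OF per d(1)] d(2)] d(3)] d(4)
    by (auto simp: E_def S_def sd_stencil_def)
  then obtain M1 where M1: "0 \<le> M1"
    and M1': "\<And>e b a x. e \<in> S \<Longrightarrow> b \<in> E \<Longrightarrow> a \<in> E \<Longrightarrow> norm (dirderiv e (dirderiv b (dirderiv a v)) x) \<le> M1"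
    by fastforce
  have c_bound: "norm (c x) \<le> M0 * kF" for x
    unfolding c_def by (intro F_bound M0' E)
  have c'_bound: "norm (dirderiv e c x) \<le> M1 * kF" if "e \<in> S" for e x
    unfolding c_dir by (intro F_bound M1' E that)
  have kF: "0 \<le> kF" by (simp add: kF_def)
  define K1 where "K1 = M0 * kF + 1"
  define K2 where "K2 = K + 6 * (sd_weight \<omega> * (M1 * kF)) + M1 * kF + 1"
  have K12: "K1 > 0" "K2 > 0"
    using K(1) M0 M1 kF sd_weight_nonneg[of \<omega>] unfolding K1_def K2_def
    by (simp_all add: add_nonneg_pos)
  show "\<exists>c1 c2 :: real. \<forall>N>0. \<forall>u. sd_solution \<omega> N v u \<longrightarrow>
         (\<forall>t\<ge>0. mesh_norm N (sd_error \<omega> N v u t) \<le> (c1 + c2 * t) * (1 / real N) ^ 2)"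
  proof (rule exI[of _ "8 * K1"], rule exI[of _ "7 * K2"], intro allI impI)
    fix N :: nat and u and t :: real
    assume N: "N > 0" and sol: "sd_solution \<omega> N v u" and t: "t \<ge> 0"
    define h where "h = 1 / real N"
    have h: "h > 0" "real N * h = 1" using N by (simp_all add: h_def)
    define g where "g s \<eta> = h\<^sup>2 *\<^sub>R c (block_point N \<eta> - s *\<^sub>R \<omega>)" for s \<eta>
    define w where "w s \<eta> = sd_error \<omega> N v u s \<eta> - g s \<eta>" for s \<eta>
    define \<tau> where "\<tau> s \<eta> = sd_residual \<omega> N v (block_point N \<eta> - s *\<^sub>R \<omega>) + real N *\<^sub>R sd_op \<omega> (g s) \<eta>
      - h\<^sup>2 *\<^sub>R dirderiv \<omega> c (block_point N \<eta> - s *\<^sub>R \<omega>)" for s \<eta>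
    have g_bound: "norm (g s \<eta>) \<le> K1 * h\<^sup>2" for s \<eta>
    proof -
      have "norm (c x) \<le> K1" for x
        using c_bound[of x] by (simp add: K1_def)
      from mult_left_mono[OF this, of "h\<^sup>2"] show ?thesis
        by (simp add: g_def mult.commute[of K1])
    qed
    have w_der: "((\<lambda>s. w s \<eta>) has_vector_derivative - (real N *\<^sub>R sd_op \<omega> (w s) \<eta>) - \<tau> s \<eta>) (at s within {0..})"
      if "s \<ge> 0" for s \<eta>
    proof -
      have "dirderiv (- \<omega>) c x = - dirderiv \<omega> c x" for x
        using dirderiv_scaleR[OF c_diff, of "-1" \<omega>] by simp
      then have "((\<lambda>s. c (block_point N \<eta> - s *\<^sub>R \<omega>)) has_vector_derivative
          - dirderiv \<omega> c (block_point N \<eta> - s *\<^sub>R \<omega>)) (at s within {0..})"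
        using dirderiv_along_line[OF c_diff, of "block_point N \<eta>" "- \<omega>" s "{0..}"] by simp
      then have "((\<lambda>s. g s \<eta>) has_vector_derivative
          h\<^sup>2 *\<^sub>R (- dirderiv \<omega> c (block_point N \<eta> - s *\<^sub>R \<omega>))) (at s within {0..})"
        unfolding g_def by (rule bounded_linear.has_vector_derivative[OF bounded_linear_scaleR_right])
      from has_vector_derivative_diff[OF sd_error_derivative[OF sol d(1) that] this]
      show ?thesis
        unfolding w_def sd_op_diff[of \<omega> "sd_error \<omega> N v u s" "g s", folded w_def] \<tau>_def w_def
          sd_op_diff by (simp add: algebra_simps)
    qed
    have \<tau>_bound: "norm (\<tau> s \<eta>) \<le> K2 * h\<^sup>2" for s \<eta>
    proof -
      define x where "x = block_point N \<eta> - s *\<^sub>R \<omega>"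
      define \<delta> where "\<delta> \<zeta> = c (x + h *\<^sub>R (real_of_int (fst \<zeta>), real_of_int (snd \<zeta>))) - c x" for \<zeta>
      define \<sigma> where "\<sigma> = (\<Sum>\<zeta>\<in>sd_stencil. sd_L \<omega> \<zeta> *v \<delta> \<zeta>)"
      have \<delta>: "norm (\<delta> \<zeta>) \<le> M1 * kF * h" if "\<zeta> \<in> sd_stencil" for \<zeta>
        unfolding \<delta>_def by (rule Taylor_order1) (use c_diff c'_bound S(2)[OF that] h in auto)
      have "norm (\<sigma> $ \<xi>) \<le> sd_weight \<omega> * (M1 * kF * h)" for \<xi>
        unfolding \<sigma>_def matrix_vector_mult_def
        using sd_weight_bound[of "\<lambda>\<zeta> \<xi>'. \<delta> \<zeta> $ \<xi>'"] order_trans[OF Finite_Cartesian_Product.norm_nth_le \<delta>]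
        by simp
      from norm_vec6_le[OF this] have \<sigma>: "norm \<sigma> \<le> 6 * (sd_weight \<omega> * (M1 * kF)) * h"
        by (simp add: algebra_simps)
      have "g s (\<eta> + \<zeta>) = h\<^sup>2 *\<^sub>R c x + h\<^sup>2 *\<^sub>R \<delta> \<zeta>" for \<zeta>
        by (simp add: g_def \<delta>_def x_def block_point_add h_def algebra_simps)
      moreover have "L *v (h\<^sup>2 *\<^sub>R y) = h\<^sup>2 *\<^sub>R (L *v y)" for L :: "complex^6^6" and y
        by (simp add: matrix_vector_mult_def vec_eq_iff scaleR_sum_right)
      ultimately have "sd_op \<omega> (g s) \<eta> = h\<^sup>2 *\<^sub>R (\<Sum>\<zeta>\<in>sd_stencil. sd_L \<omega> \<zeta> *v c x) + h\<^sup>2 *\<^sub>R \<sigma>"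
        by (simp add: sd_op_def matrix_vector_right_distrib sum.distrib \<sigma>_def scaleR_sum_right)
      also have "(\<Sum>\<zeta>\<in>sd_stencil. sd_L \<omega> \<zeta> *v c x) = - quadratic_residual \<omega> (?p x) (?r x) (?q x)"
        unfolding c_def F_def by (rule corr)
      finally have "real N *\<^sub>R sd_op \<omega> (g s) \<eta> = (real N * h * h) *\<^sub>R (\<sigma> - quadratic_residual \<omega> (?p x) (?r x) (?q x))"
        by (simp add: power2_eq_square scaleR_diff_right mult.assoc)
      then have "\<tau> s \<eta> = (sd_residual \<omega> N v x - h *\<^sub>R quadratic_residual \<omega> (?p x) (?r x) (?q x))
          + h *\<^sub>R \<sigma> - h\<^sup>2 *\<^sub>R dirderiv \<omega> c x"
        unfolding \<tau>_def x_def[symmetric] h(2) by (simp add: algebra_simps)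
      also have "norm \<dots> \<le> norm (sd_residual \<omega> N v x - h *\<^sub>R quadratic_residual \<omega> (?p x) (?r x) (?q x))
          + h * norm \<sigma> + h\<^sup>2 * norm (dirderiv \<omega> c x)"
        using h(1) norm_triangle_ineq4[of "(sd_residual \<omega> N v x - h *\<^sub>R quadratic_residual \<omega> (?p x) (?r x) (?q x))
          + h *\<^sub>R \<sigma>" "h\<^sup>2 *\<^sub>R dirderiv \<omega> c x"]
          norm_triangle_ineq[of "sd_residual \<omega> N v x - h *\<^sub>R quadratic_residual \<omega> (?p x) (?r x) (?q x)" "h *\<^sub>R \<sigma>"]
        by simp
      also have "\<dots> \<le> K * h\<^sup>2 + h * (6 * (sd_weight \<omega> * (M1 * kF)) * h) + h\<^sup>2 * (M1 * kF)"
        using K(2)[rule_format, OF N, of x] \<sigma> c'_bound[OF S(1), of x] h(1) unfolding h_def[symmetric]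
        by (intro add_mono mult_left_mono) auto
      also have "\<dots> = (K2 - 1) * h\<^sup>2"
        by (simp add: K2_def power2_eq_square algebra_simps)
      also have "\<dots> \<le> K2 * h\<^sup>2"
        by (intro mult_right_mono) auto
      finally show ?thesis .
    qed
    have "mesh_norm N (w t) \<le> 7 * (K1 * h\<^sup>2 + K2 * h\<^sup>2 * t)"
    proof (rule sd_stability[OF N less_imp_le[OF \<omega>(1)] less_imp_le[OF \<omega>(2)] _ w_der _ _ _ \<tau>_bound t])
      show "mesh_periodic N (w s)" if "s \<ge> 0" for s
        using mesh_periodic_sd_error[OF sol per N that] per_c[OF N]
        by (simp add: mesh_periodic_def w_def g_def)
      show "norm (w 0 \<eta>) \<le> K1 * h\<^sup>2" for \<eta>
        using g_bound[of 0 \<eta>] by (simp add: w_def sd_error_initial[OF sol])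
    qed (use h K12 in auto)
    moreover have "mesh_norm N (sd_error \<omega> N v u t) \<le> mesh_norm N (w t) + K1 * h\<^sup>2"
      by (rule mesh_norm_perturbation[OF N]) (simp add: w_def g_bound)
    ultimately show "mesh_norm N (sd_error \<omega> N v u t) \<le> (8 * K1 + 7 * K2 * t) * (1 / real N) ^ 2"
      unfolding h_def[symmetric] by (simp add: algebra_simps)
  qed
qed

section \<open>A Fourier mode of the scheme\<close>

text \<open>
  The components of \<open>exp (t A) w0\<close> are entire power series in \<open>t\<close>, which may be differentiated term by
  term.
\<close>

lemma linear_ode_solution:
  fixes A :: "complex^6^6" and w0 :: "complex^6"
  obtains w where "w 0 = w0" "\<forall>t::real. (w has_vector_derivative A *v w t) (at t)"
proof -
  define v where "v n = (((*v) A) ^^ n) w0" for n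
  define c where "c i n = v n $ i / fact n" for i n
  define K where "K = 6 * (\<Sum>i\<in>UNIV. \<Sum>j\<in>UNIV. norm (A $ i $ j))"
  have K0: "K \<ge> 0" unfolding K_def by (intro mult_nonneg_nonneg sum_nonneg) auto
  have A_bound: "norm (A *v x) \<le> K * norm x" for x
  proof -
    have "norm ((A *v x) $ i) \<le> (\<Sum>i\<in>UNIV. \<Sum>j\<in>UNIV. norm (A $ i $ j)) * norm x" for i
    proof -
      have "norm ((A *v x) $ i) \<le> (\<Sum>j\<in>UNIV. norm (A $ i $ j) * norm x)"
        unfolding matrix_vector_mult_def
        by (auto intro!: sum_norm_le simp: norm_mult mult_left_mono Finite_Cartesian_Product.norm_nth_le)
      also have "\<dots> = (\<Sum>j\<in>UNIV. norm (A $ i $ j)) * norm x"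
        by (simp add: sum_distrib_right)
      also have "\<dots> \<le> (\<Sum>i\<in>UNIV. \<Sum>j\<in>UNIV. norm (A $ i $ j)) * norm x"
        by (intro mult_right_mono member_le_sum[of i UNIV "\<lambda>i. \<Sum>j\<in>UNIV. norm (A $ i $ j)"])
           (auto intro!: sum_nonneg)
      finally show ?thesis .
    qed
    from norm_vec6_le[OF this] show ?thesis by (simp add: K_def)
  qed
  have v_bound: "norm (v n) \<le> K ^ n * norm w0" for n
  proof (induction n)
    case (Suc n)
    have "norm (v (Suc n)) \<le> K * norm (v n)"
      using A_bound by (simp add: v_def)
    also have "\<dots> \<le> K * (K ^ n * norm w0)"
      by (intro mult_left_mono Suc K0)
    finally show ?case by simp
  qed (simp add: v_def)
  have summ: "summable (\<lambda>n. c i n * z ^ n)" for i z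
  proof (rule summable_comparison_test')
    show "summable (\<lambda>n. norm w0 * (inverse (fact n) * (K * norm z) ^ n))"
      by (intro summable_mult summable_exp)
    fix n :: nat assume "n \<ge> 0"
    have "norm (v n $ i) \<le> K ^ n * norm w0"
      by (rule order_trans[OF Finite_Cartesian_Product.norm_nth_le v_bound])
    then have "norm (v n $ i) * norm z ^ n \<le> (K ^ n * norm w0) * norm z ^ n"
      by (rule mult_right_mono) simp
    then have "norm (v n $ i) * norm z ^ n / fact n \<le> (K ^ n * norm w0) * norm z ^ n / fact n"
      by (rule divide_right_mono) simp
    then show "norm (c i n * z ^ n) \<le> norm w0 * (inverse (fact n) * (K * norm z) ^ n)"
      by (simp add: c_def norm_mult norm_power norm_divide power_mult_distrib field_simps)
  qed
  define W where "W i z = (\<Sum>n. c i n * z ^ n)" for i z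
  have diffs_c: "diffs (c i) n * z ^ n = (\<Sum>j\<in>UNIV. A $ i $ j * (c j n * z ^ n))" for i n z
  proof -
    have "(1 + of_nat n :: complex) \<noteq> 0"
      by (metis of_nat_Suc of_nat_neq_0)
    then have "diffs (c i) n = (A *v v n) $ i / fact n"
      by (simp add: diffs_def c_def v_def divide_simps)
    also have "\<dots> = (\<Sum>j\<in>UNIV. A $ i $ j * c j n)"
      by (simp add: matrix_vector_mult_def c_def sum_divide_distrib)
    finally show ?thesis
      by (simp add: sum_distrib_right mult.assoc)
  qed
  have W_der: "(W i has_field_derivative (\<Sum>j\<in>UNIV. A $ i $ j * W j z)) (at z)" for i z
  proof -
    have "(\<lambda>n. diffs (c i) n * z ^ n) sums (\<Sum>j\<in>UNIV. A $ i $ j * W j z)"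
      unfolding diffs_c W_def by (intro sums_sum sums_mult summable_sums summ)
    then show ?thesis
      using termdiffs_strong_converges_everywhere[OF summ, of i z]
      unfolding W_def[abs_def] by (simp add: sums_iff)
  qed
  show thesis
  proof (rule that[of "\<lambda>t. \<chi> i. W i (of_real t)"]; (intro allI)?)
    show "(\<chi> i. W i (of_real 0)) = w0"
    proof -
      have "W i 0 = c i 0" for i
        unfolding W_def by (rule powser_zero)
      then show ?thesis
        by (simp add: vec_eq_iff c_def v_def)
    qed
    show "((\<lambda>t. \<chi> i. W i (of_real t)) has_vector_derivative A *v (\<chi> i. W i (of_real t))) (at t)" for t
    proof (rule has_vector_derivative_vec)
      fix i
      show "((\<lambda>s. (\<chi> i. W i (of_real s)) $ i) has_vector_derivative (A *v (\<chi> i. W i (of_real t))) $ i) (at t)"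
        using has_vector_derivative_real_field[OF W_der[of i "of_real t"], of UNIV]
        by (simp add: matrix_vector_mult_def)
    qed
  qed
qed

definition x_wave :: "real \<times> real \<Rightarrow> complex" where
  "x_wave r = exp (\<i> * of_real (2 * pi * fst r))"

lemma x_wave_add: "x_wave (r + s) = x_wave r * x_wave s"
  by (simp add: x_wave_def exp_add[symmetric] algebra_simps)

lemma norm_x_wave [simp]: "norm (x_wave r) = 1"
  by (simp add: x_wave_def norm_exp_i_times)

lemma x_wave_0 [simp]: "x_wave 0 = 1" "x_wave (0, 0) = 1"
  by (simp_all add: x_wave_def)

lemma periodic1_x_wave: "periodic1 x_wave"
proof -
  have "exp (\<i> * of_real (2 * pi * (x + 1))) = exp (\<i> * of_real (2 * pi * x))" for x
    using exp_plus_2pin[of "\<i> * of_real (2 * pi * x)" 1] by (simp add: algebra_simps)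
  then show ?thesis
    by (simp add: periodic1_def x_wave_def)
qed

lemma x_wave_derivative:
  "((\<lambda>r. c * x_wave r) has_derivative (\<lambda>b. (c * (\<i> * of_real (2 * pi * fst b))) * x_wave r)) (at r)"
proof -
  have "((\<lambda>r. \<i> * of_real (2 * pi * fst r)) has_derivative (\<lambda>b. \<i> * of_real (2 * pi * fst b))) (at r)"
    by (auto intro!: derivative_eq_intros)
  moreover have "(exp has_derivative (*) (exp (\<i> * of_real (2 * pi * fst r)))) (at (\<i> * of_real (2 * pi * fst r)))"
    using DERIV_exp[of "\<i> * of_real (2 * pi * fst r)"] by (simp add: has_field_derivative_def)
  ultimately have "((\<lambda>r. exp (\<i> * of_real (2 * pi * fst r))) has_derivative
      (\<lambda>b. exp (\<i> * of_real (2 * pi * fst r)) * (\<i> * of_real (2 * pi * fst b)))) (at r)"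
    by (rule has_derivative_compose)
  from has_derivative_mult_right[OF this, of c] show ?thesis
    by (simp add: x_wave_def algebra_simps)
qed

lemma dirderiv_x_wave:
  "dirderiv b (\<lambda>r. c * x_wave r) = (\<lambda>r. (c * (\<i> * of_real (2 * pi * fst b))) * x_wave r)"
  by (rule ext) (simp add: dirderiv_def flip: frechet_derivative_at[OF x_wave_derivative])

lemma C_k_x_wave: "C_k k (\<lambda>r. c * x_wave r)"
proof (induction k arbitrary: c)
  case 0
  then show ?case
    using has_derivative_continuous[OF x_wave_derivative]
    by (auto intro: continuous_at_imp_continuous_on)
next
  case (Suc k)
  show ?case
    unfolding C_k_Suc_iff dirderiv_x_wave
    using Suc x_wave_derivative differentiable_def by blast
qed

text \<open>
  The action of the spatial operator on the amplitude of the Fourier mode \<open>exp (2 \<pi> \<i> x)\<close>.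
\<close>

definition sd_symbol :: "real \<times> real \<Rightarrow> nat \<Rightarrow> complex^6 \<Rightarrow> complex^6" where
  "sd_symbol \<omega> N y = (\<Sum>\<zeta>\<in>sd_stencil. sd_L \<omega> \<zeta> *v (x_wave (block_point N \<zeta>) *s y))"

lemma sd_symbol_nth:
  "sd_symbol \<omega> N y $ \<xi> = (\<Sum>\<zeta>\<in>sd_stencil. \<Sum>\<xi>'\<in>UNIV. sd_L \<omega> \<zeta> $ \<xi> $ \<xi>' * (x_wave (block_point N \<zeta>) * y $ \<xi>'))"
  by (simp add: sd_symbol_def matrix_vector_mult_def)

lemma sd_symbol_add: "sd_symbol \<omega> N (x + y) = sd_symbol \<omega> N x + sd_symbol \<omega> N y"
  by (simp add: vec_eq_iff sd_symbol_nth distrib_left sum.distrib)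

lemma sd_symbol_scale: "sd_symbol \<omega> N (c *s y) = c *s sd_symbol \<omega> N y"
  by (simp add: vec_eq_iff sd_symbol_nth sum_distrib_left mult_ac)

lemma norm_unit_scale: "norm c = 1 \<Longrightarrow> norm (c *s (y :: complex^6)) = norm y"
  by (simp add: norm_vec_def norm_mult)

lemma has_vector_derivative_vector_scalar:
  fixes y :: "real \<Rightarrow> complex^6"
  assumes "(f has_vector_derivative f') (at t within S)" "(y has_vector_derivative y') (at t within S)"
  shows "((\<lambda>s. f s *s y s) has_vector_derivative f t *s y' + f' *s y t) (at t within S)"
proof (rule has_vector_derivative_vec)
  fix i
  have "((\<lambda>s. y s $ i) has_vector_derivative y' $ i) (at t within S)"
    by (rule bounded_linear.has_vector_derivative[OF bounded_linear_vec_nth assms(2)])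
  from has_vector_derivative_mult[OF assms(1) this]
  show "((\<lambda>s. (f s *s y s) $ i) has_vector_derivative (f t *s y' + f' *s y t) $ i) (at t within S)"
    by simp
qed

lemma x_wave_lagrange:
  "x_wave ((1 / real N) *\<^sub>R node \<zeta> \<xi>) = x_wave (block_point N \<zeta>) * sd_lagrange N x_wave (0, 0) $ \<xi>"
proof -
  have "(1 / real N) *\<^sub>R node \<zeta> \<xi> = block_point N \<zeta> + (1 / real N) *\<^sub>R node (0, 0) \<xi>"
    by (simp add: node_def block_point_def prod_eq_iff add_divide_distrib)
  moreover have "sd_lagrange N x_wave (0, 0) $ \<xi> = x_wave ((1 / real N) *\<^sub>R node (0, 0) \<xi>)"
    by (simp add: sd_lagrange_def node_def)
  ultimately show ?thesis
    by (simp only: x_wave_add)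
qed

lemma block_point_0 [simp]: "block_point N (0, 0) = 0"
  by (simp add: block_point_def prod_eq_iff)

lemma dirderiv_x_wave1: "dirderiv b x_wave r = \<i> * of_real (2 * pi * fst b) * x_wave r"
  using fun_cong[OF dirderiv_x_wave[of b 1], of r] by simp

lemma x_wave_residual:
  "sd_residual \<omega> N x_wave 0 = real N *\<^sub>R sd_symbol \<omega> N (sd_lagrange N x_wave (0, 0))
     - (\<i> * of_real (2 * pi * fst \<omega>)) *s sd_lagrange N x_wave (0, 0)"
  unfolding vec_eq_iff
proof
  fix \<xi>
  show "sd_residual \<omega> N x_wave 0 $ \<xi> = (real N *\<^sub>R sd_symbol \<omega> N (sd_lagrange N x_wave (0, 0))
     - (\<i> * of_real (2 * pi * fst \<omega>)) *s sd_lagrange N x_wave (0, 0)) $ \<xi>"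
    by (simp add: sd_residual_def sd_symbol_nth dirderiv_x_wave1 x_wave_lagrange del: of_real_mult)
qed

text \<open>
  All blocks carry the same amplitude \<open>w\<close> up to a phase, so the mesh norm of the error is the norm of an
  error of amplitudes.  The order is a statement about all solutions, so an upper bound for it requires that
  one exists.
\<close>

lemma x_wave_solution:
  assumes N: "N > 0"
  obtains u w where "sd_solution \<omega> N x_wave u" "w 0 = sd_lagrange N x_wave (0, 0)"
    "\<forall>t. (w has_vector_derivative - (real N *\<^sub>R sd_symbol \<omega> N (w t))) (at t)"
    "\<forall>t. mesh_norm N (sd_error \<omega> N x_wave u t) = norm (w t - x_wave (- t *\<^sub>R \<omega>) *s w 0)"
proof -
  define A :: "complex^6^6" where
    "A = (\<chi> i j. - (of_nat N * (\<Sum>\<zeta>\<in>sd_stencil. sd_L \<omega> \<zeta> $ i $ j * x_wave (block_point N \<zeta>))))"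
  have A: "A *v y = - (real N *\<^sub>R sd_symbol \<omega> N y)" for y
    unfolding vec_eq_iff
  proof
    fix i
    have "(A *v y) $ i = - (of_nat N * (\<Sum>j\<in>UNIV. \<Sum>\<zeta>\<in>sd_stencil. sd_L \<omega> \<zeta> $ i $ j * x_wave (block_point N \<zeta>) * y $ j))"
      by (simp add: A_def matrix_vector_mult_def sum_negf sum_distrib_left sum_distrib_right mult.assoc)
    also have "\<dots> = (- (real N *\<^sub>R sd_symbol \<omega> N y)) $ i"
      unfolding sum.swap[of _ sd_stencil] by (simp add: sd_symbol_nth scaleR_conv_of_real[where 'a = complex] mult.assoc)
    finally show "(A *v y) $ i = (- (real N *\<^sub>R sd_symbol \<omega> N y)) $ i" .
  qed
  obtain w where w0: "w 0 = sd_lagrange N x_wave (0, 0)"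
    and w: "\<forall>t. (w has_vector_derivative A *v w t) (at t)"
    by (rule linear_ode_solution[of "sd_lagrange N x_wave (0, 0)" A])
  have lag: "sd_lagrange N (exact_solution \<omega> x_wave t) \<eta> = x_wave (block_point N \<eta>) *s (x_wave (- t *\<^sub>R \<omega>) *s w 0)" for t \<eta>
    unfolding vec_eq_iff
  proof
    fix \<xi>
    have "sd_lagrange N (exact_solution \<omega> x_wave t) \<eta> $ \<xi>
        = x_wave (block_point N \<eta> + (- t *\<^sub>R \<omega>) + (1 / real N) *\<^sub>R node (0, 0) \<xi>)"
      using sd_lagrange_exact[of N \<omega> x_wave t \<eta> "(0, 0)" \<xi>] by (simp flip: zero_prod_def)
    then show "sd_lagrange N (exact_solution \<omega> x_wave t) \<eta> $ \<xi>
        = (x_wave (block_point N \<eta>) *s (x_wave (- t *\<^sub>R \<omega>) *s w 0)) $ \<xi>"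
      unfolding x_wave_add x_wave_lagrange w0 by (simp add: mult.assoc)
  qed
  define u where "u t \<eta> = x_wave (block_point N \<eta>) *s w t" for t \<eta>
  have sol: "sd_solution \<omega> N x_wave u"
    unfolding sd_solution_def
  proof (intro conjI allI impI)
    have "exact_solution \<omega> x_wave 0 = x_wave"
      by (rule ext) (simp add: exact_solution_def)
    then show "u 0 = sd_lagrange N x_wave"
      using lag[of 0] by (intro ext) (simp add: u_def)
    fix t :: real
    show "mesh_periodic N (u t)"
      using mesh_periodic_shift[OF periodic1_x_wave N, where x = 0 and y = 0]
      by (simp add: mesh_periodic_def u_def)
    fix \<eta>
    have "sd_op \<omega> (u t) \<eta> = x_wave (block_point N \<eta>) *s sd_symbol \<omega> N (w t)"
      unfolding vec_eq_iff
    proof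
      fix \<xi>
      have "x_wave (block_point N (\<eta> + \<zeta>)) = x_wave (block_point N \<eta>) * x_wave (block_point N \<zeta>)" for \<zeta>
        unfolding x_wave_add[symmetric] block_point_add by (simp add: block_point_def)
      then show "sd_op \<omega> (u t) \<eta> $ \<xi> = (x_wave (block_point N \<eta>) *s sd_symbol \<omega> N (w t)) $ \<xi>"
        by (simp add: sd_op_nth sd_symbol_nth u_def sum_distrib_left mult_ac)
    qed
    then have "- (real N *\<^sub>R (\<Sum>\<zeta>\<in>sd_stencil. sd_L \<omega> \<zeta> *v u t (\<eta> + \<zeta>)))
        = x_wave (block_point N \<eta>) *s (A *v w t) + 0 *s w t"
      unfolding A sd_op_def[symmetric] by (simp add: vec_eq_iff)
    then show "((\<lambda>s. u s \<eta>) has_vector_derivative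
        - (real N *\<^sub>R (\<Sum>\<zeta>\<in>sd_stencil. sd_L \<omega> \<zeta> *v u t (\<eta> + \<zeta>)))) (at t within {0..})"
      unfolding u_def
      using has_vector_derivative_vector_scalar[OF has_vector_derivative_const
          has_vector_derivative_at_within[OF w[rule_format]]] by metis
  qed
  have err: "norm (sd_error \<omega> N x_wave u t \<eta>) = norm (w t - x_wave (- t *\<^sub>R \<omega>) *s w 0)" for t \<eta>
  proof -
    have "sd_error \<omega> N x_wave u t \<eta> = x_wave (block_point N \<eta>) *s (w t - x_wave (- t *\<^sub>R \<omega>) *s w 0)"
      unfolding sd_error_def lag u_def by (simp add: vec_eq_iff algebra_simps)
    then show ?thesis
      by (simp only: norm_unit_scale norm_x_wave)
  qed
  have "mesh_norm N (sd_error \<omega> N x_wave u t) = norm (w t - x_wave (- t *\<^sub>R \<omega>) *s w 0)" for t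
    unfolding mesh_norm_def err using N by (simp add: card_cartesian_product power2_eq_square)
  then show thesis
    by (intro that[OF sol w0 w[unfolded A]] allI)
qed

section \<open>The order from above\<close>

lemma quadratic_residual_scale: "quadratic_residual \<omega> p 0 0 $ \<xi> = p * quadratic_residual \<omega> 1 0 0 $ \<xi>"
proof -
  have "\<forall>\<xi>. quadratic_residual \<omega> p 0 0 $ \<xi> = p * quadratic_residual \<omega> 1 0 0 $ \<xi>"
    unfolding forall_6 quadratic_residual_def Let_def by simp
  then show ?thesis by blast
qed

text \<open>
  The amplitude of the error in the moving frame, \<open>Z\<close>, satisfies \<open>Z' = \<kappa> Z - (1 / h) \<Lambda> Z - \<rho>\<close>, where \<open>\<Lambda>\<close> is the
  symbol and \<open>\<rho>\<close> does not depend on time.  If \<open>Z = O(h\<^sup>q)\<close> and \<open>\<mu> \<cdot> \<Lambda> Z = O(h\<^sup>m |Z|)\<close> with \<open>m + q = 3\<close>, then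
  every term other than \<open>\<mu> \<cdot> \<rho>\<close> is \<open>O(h\<^sup>2)\<close> after integration over \<open>0 \<le> t \<le> 1\<close>, and so \<open>\<mu> \<cdot> \<rho> = O(h\<^sup>2)\<close>.
  But \<open>\<rho>\<close> is \<open>h\<close> times a fixed vector plus \<open>O(h\<^sup>2)\<close>, so \<open>\<mu>\<close> annihilates this vector.
\<close>

lemma sd_order_obstruction:
  fixes \<mu> :: "complex^6"
  assumes ord: "sd_has_order \<omega> q'" and q: "q \<le> q'" "2 \<le> q" "m + q = 3"
    and \<mu>: "\<And>N y. N > 0 \<Longrightarrow> norm (\<Sum>\<xi>\<in>UNIV. \<mu> $ \<xi> * sd_symbol \<omega> N y $ \<xi>) \<le> B * (1 / real N) ^ m * norm y"
  shows "(\<Sum>\<xi>\<in>UNIV. \<mu> $ \<xi> * quadratic_residual \<omega> 1 0 0 $ \<xi>) = 0"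
proof -
  define \<phi> where "\<phi> y = (\<Sum>\<xi>\<in>UNIV. \<mu> $ \<xi> * y $ \<xi>)" for y :: "complex^6"
  define \<Lambda> where "\<Lambda> = (\<Sum>\<xi>\<in>UNIV. norm (\<mu> $ \<xi>))"
  have \<Lambda>0: "0 \<le> \<Lambda>" unfolding \<Lambda>_def by (intro sum_nonneg) auto
  have \<phi>_bound: "norm (\<phi> y) \<le> \<Lambda> * norm y" for y
    unfolding \<phi>_def \<Lambda>_def sum_distrib_right
    by (auto intro!: sum_norm_le simp: norm_mult mult_left_mono Finite_Cartesian_Product.norm_nth_le)
  have \<phi>_add: "\<phi> (x + y) = \<phi> x + \<phi> y" and \<phi>_scaleR: "\<phi> (c *\<^sub>R y) = c *\<^sub>R \<phi> y"
    and \<phi>_scale: "\<phi> (a *s y) = a * \<phi> y" for x y c a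
    by (simp_all add: \<phi>_def distrib_left sum.distrib scaleR_sum_right sum_distrib_left mult_ac)
  have \<phi>_lin: "bounded_linear \<phi>"
    by (rule bounded_linear_intro[where K = \<Lambda>]) (simp_all add: \<phi>_add \<phi>_scaleR \<phi>_bound mult.commute)
  note \<phi>_diff = linear_diff[OF bounded_linear.linear[OF \<phi>_lin]]
  have "C_k (q' + 1) x_wave"
    using C_k_x_wave[of "q' + 1" 1] by simp
  then obtain c1 c2 where c12: "\<And>N u t. N > 0 \<Longrightarrow> sd_solution \<omega> N x_wave u \<Longrightarrow> t \<ge> 0 \<Longrightarrow>
      mesh_norm N (sd_error \<omega> N x_wave u t) \<le> (c1 + c2 * t) * (1 / real N) ^ q'"
    using ord periodic1_x_wave unfolding sd_has_order_def by metis
  define C where "C = \<bar>c1\<bar> + \<bar>c2\<bar>"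
  have C0: "0 \<le> C" by (simp add: C_def)
  have "C_k 3 x_wave"
    using C_k_x_wave[of 3 1] by simp
  from periodic1_x_wave this obtain K where K: "0 \<le> K" "\<forall>N>0. \<forall>x. norm (sd_residual \<omega> N x_wave x
     - (1 / real N) *\<^sub>R quadratic_residual \<omega> (dirderiv (1, 0) (dirderiv (1, 0) x_wave) x)
         (dirderiv (1, 0) (dirderiv (0, 1) x_wave) x) (dirderiv (0, 1) (dirderiv (0, 1) x_wave) x))
     \<le> K * (1 / real N)\<^sup>2"
    by (rule sd_residual_order2[of x_wave \<omega>])
  have dir: "dirderiv b x_wave = (\<lambda>r. (\<i> * of_real (2 * pi * fst b)) * x_wave r)" for b
    using dirderiv_x_wave[of b 1] by simp
  define p :: complex where "p = (\<i> * of_real (2 * pi)) * (\<i> * of_real (2 * pi))"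
  have p: "p \<noteq> 0" by (simp add: p_def)
  have der2: "dirderiv (1, 0) (dirderiv (1, 0) x_wave) 0 = p"
    "dirderiv (1, 0) (dirderiv (0, 1) x_wave) 0 = 0" "dirderiv (0, 1) (dirderiv (0, 1) x_wave) 0 = 0"
    unfolding dir dirderiv_x_wave by (simp_all add: p_def)
  define \<kappa> :: complex where "\<kappa> = \<i> * of_real (2 * pi * fst \<omega>)"
  define c where "c = p * \<phi> (quadratic_residual \<omega> 1 0 0)"
  have \<phi>_quad: "\<phi> (quadratic_residual \<omega> p 0 0) = c"
    by (simp add: \<phi>_def c_def quadratic_residual_scale[of \<omega> p] sum_distrib_left mult_ac)
  define M where "M = norm \<kappa> * \<Lambda> * C + \<bar>B\<bar> * C + \<Lambda> * C + \<Lambda> * K"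
  have main: "norm c \<le> M * (1 / real N)" if N: "N > 0" for N
  proof -
    define h where "h = 1 / real N"
    have h: "0 < h" "h \<le> 1" "real N * h = 1"
      using N by (simp_all add: h_def)
    obtain u w where sol: "sd_solution \<omega> N x_wave u" and w0: "w 0 = sd_lagrange N x_wave (0, 0)"
      and w: "\<forall>t. (w has_vector_derivative - (real N *\<^sub>R sd_symbol \<omega> N (w t))) (at t)"
      and err: "\<forall>t. mesh_norm N (sd_error \<omega> N x_wave u t) = norm (w t - x_wave (- t *\<^sub>R \<omega>) *s w 0)"
      by (rule x_wave_solution[OF N, of \<omega>])
    define e where "e t = x_wave (0 + t *\<^sub>R \<omega>)" for t
    define Z where "Z t = e t *s w t - w 0" for t
    define \<rho> where "\<rho> = sd_residual \<omega> N x_wave 0"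
    have e_inv: "e t * x_wave (- (t *\<^sub>R \<omega>)) = 1" for t
      unfolding e_def x_wave_add[symmetric] by simp
    have Z_err: "norm (Z t) = mesh_norm N (sd_error \<omega> N x_wave u t)" for t
    proof -
      have Z: "Z t = e t *s (w t - x_wave (- t *\<^sub>R \<omega>) *s w 0)"
        by (simp add: Z_def vec_eq_iff right_diff_distrib mult.assoc[symmetric] e_inv)
      show ?thesis
        unfolding err[rule_format] Z by (rule norm_unit_scale) (simp add: e_def)
    qed
    have Z_bound: "norm (Z t) \<le> C * h ^ q" if "0 \<le> t" "t \<le> 1" for t
    proof -
      have "norm (Z t) \<le> (c1 + c2 * t) * h ^ q'"
        unfolding Z_err h_def by (rule c12[OF N sol that(1)])
      also have "\<dots> \<le> C * h ^ q'"
      proof (rule mult_right_mono)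
        have "c2 * t \<le> \<bar>c2\<bar> * 1"
          using that by (intro mult_mono) auto
        then show "c1 + c2 * t \<le> C"
          by (simp add: C_def)
      qed (use h in simp)
      also have "\<dots> \<le> C * h ^ q"
        using h q(1) C0 by (intro mult_left_mono power_decreasing) auto
      finally show ?thesis .
    qed
    have e_der: "(e has_vector_derivative \<kappa> * e t) (at t)" for t
    proof -
      have "\<And>x. x_wave differentiable (at x)"
        using C_k_3D(1)[OF \<open>C_k 3 x_wave\<close>] .
      from dirderiv_along_line[OF this, of 0 \<omega> t UNIV] show ?thesis
        unfolding e_def dirderiv_x_wave1 \<kappa>_def .
    qed
    have Z_der: "(Z has_vector_derivative \<kappa> *s Z t - real N *\<^sub>R sd_symbol \<omega> N (Z t) - \<rho>) (at t)" for t
    proof -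
      have ew: "e t *s w t = Z t + w 0" by (simp add: Z_def)
      have "e t *s sd_symbol \<omega> N (w t) = sd_symbol \<omega> N (Z t) + sd_symbol \<omega> N (w 0)"
        unfolding sd_symbol_scale[symmetric] ew by (rule sd_symbol_add)
      moreover have "(\<kappa> * e t) *s w t = \<kappa> *s Z t + \<kappa> *s w 0"
        unfolding vector_smult_assoc[symmetric] ew by (rule vector_add_ldistrib)
      moreover have "e t *s (- (real N *\<^sub>R y)) = - (real N *\<^sub>R (e t *s y))" for y :: "complex^6"
        by (simp add: vec_eq_iff)
      ultimately have eq: "e t *s (- (real N *\<^sub>R sd_symbol \<omega> N (w t))) + (\<kappa> * e t) *s w t
          = \<kappa> *s Z t - real N *\<^sub>R sd_symbol \<omega> N (Z t) - \<rho>"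
        unfolding \<rho>_def x_wave_residual w0[symmetric] \<kappa>_def[symmetric]
        by (simp add: scaleR_add_right)
      have "(Z has_vector_derivative e t *s (- (real N *\<^sub>R sd_symbol \<omega> N (w t))) + (\<kappa> * e t) *s w t - 0) (at t)"
        unfolding Z_def[abs_def]
        by (rule has_vector_derivative_diff[OF has_vector_derivative_vector_scalar[OF e_der w[rule_format]]
              has_vector_derivative_const])
      then show ?thesis
        unfolding eq by simp
    qed
    \<comment> \<open>The added linear term cancels \<open>\<rho>\<close> in the derivative, so \<open>G\<close> changes by \<open>O(h\<^sup>2)\<close> only.\<close>
    define G where "G t = \<phi> (Z t) + t *\<^sub>R \<phi> \<rho>" for t
    define b where "b = (norm \<kappa> * \<Lambda> * C + \<bar>B\<bar> * C) * h\<^sup>2"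
    have "norm (G 1 - G 0) \<le> b * 1"
    proof (rule norm_increment_le)
      fix t :: real assume t: "0 \<le> t" "t \<le> 1"
      have "((\<lambda>t. \<phi> (Z t)) has_vector_derivative \<phi> (\<kappa> *s Z t - real N *\<^sub>R sd_symbol \<omega> N (Z t) - \<rho>)) (at t within {0..1})"
        by (rule bounded_linear.has_vector_derivative[OF \<phi>_lin has_vector_derivative_at_within[OF Z_der]])
      moreover have "((\<lambda>t. t *\<^sub>R \<phi> \<rho>) has_vector_derivative \<phi> \<rho>) (at t within {0..1})"
        by (auto intro!: derivative_eq_intros)
      ultimately have "(G has_vector_derivative \<phi> (\<kappa> *s Z t - real N *\<^sub>R sd_symbol \<omega> N (Z t) - \<rho>) + \<phi> \<rho>) (at t within {0..1})"
        unfolding G_def by (rule has_vector_derivative_add)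
      then show "(G has_vector_derivative \<kappa> * \<phi> (Z t) - real N *\<^sub>R \<phi> (sd_symbol \<omega> N (Z t))) (at t within {0..1})"
        by (simp add: \<phi>_diff \<phi>_scale \<phi>_scaleR)
      have "norm (\<kappa> * \<phi> (Z t)) \<le> norm \<kappa> * (\<Lambda> * (C * h\<^sup>2))"
      proof -
        have "h ^ q \<le> h\<^sup>2"
          using h q(2) by (intro power_decreasing) auto
        then have "norm (Z t) \<le> C * h\<^sup>2"
          using Z_bound[OF t] C0 by (meson mult_left_mono order_trans)
        then have "norm (\<phi> (Z t)) \<le> \<Lambda> * (C * h\<^sup>2)"
          using \<phi>_bound[of "Z t"] \<Lambda>0 by (meson mult_left_mono order_trans)
        then show ?thesis
          by (simp add: norm_mult mult_left_mono)
      qed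
      moreover have "real N * norm (\<phi> (sd_symbol \<omega> N (Z t))) \<le> real N * (\<bar>B\<bar> * h ^ m * (C * h ^ q))"
      proof (rule mult_left_mono)
        have "norm (\<phi> (sd_symbol \<omega> N (Z t))) \<le> B * h ^ m * norm (Z t)"
          unfolding \<phi>_def h_def by (rule \<mu>[OF N])
        also have "\<dots> \<le> \<bar>B\<bar> * h ^ m * (C * h ^ q)"
          using h(1) by (intro mult_mono Z_bound t) auto
        finally show "norm (\<phi> (sd_symbol \<omega> N (Z t))) \<le> \<bar>B\<bar> * h ^ m * (C * h ^ q)" .
      qed simp
      moreover have "real N * (\<bar>B\<bar> * h ^ m * (C * h ^ q)) = \<bar>B\<bar> * C * h\<^sup>2"
      proof -
        have "h ^ m * h ^ q = h * h\<^sup>2"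
          unfolding power_add[symmetric] q(3) by (simp add: power2_eq_square power3_eq_cube)
        then have "real N * (\<bar>B\<bar> * h ^ m * (C * h ^ q)) = (real N * h) * (\<bar>B\<bar> * C * h\<^sup>2)"
          by (simp add: mult_ac)
        then show ?thesis by (simp add: h(3))
      qed
      moreover have "norm (\<kappa> * \<phi> (Z t) - real N *\<^sub>R \<phi> (sd_symbol \<omega> N (Z t)))
          \<le> norm (\<kappa> * \<phi> (Z t)) + real N * norm (\<phi> (sd_symbol \<omega> N (Z t)))"
        using norm_triangle_ineq4[of "\<kappa> * \<phi> (Z t)" "real N *\<^sub>R \<phi> (sd_symbol \<omega> N (Z t))"] by simp
      moreover have "b = norm \<kappa> * (\<Lambda> * (C * h\<^sup>2)) + \<bar>B\<bar> * C * h\<^sup>2"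
        by (simp add: b_def algebra_simps)
      ultimately show "norm (\<kappa> * \<phi> (Z t) - real N *\<^sub>R \<phi> (sd_symbol \<omega> N (Z t))) \<le> b"
        by linarith
    qed simp
    moreover have "G 0 = 0"
    proof -
      have "Z 0 = 0" by (simp add: Z_def e_def vec_eq_iff)
      then show ?thesis by (simp add: G_def \<phi>_def)
    qed
    moreover have "norm (\<phi> (Z 1)) \<le> \<Lambda> * C * h\<^sup>2"
    proof -
      have "h ^ q \<le> h\<^sup>2"
        using h q(2) by (intro power_decreasing) auto
      then have "norm (Z 1) \<le> C * h\<^sup>2"
        using Z_bound[of 1] C0 by (meson mult_left_mono order_trans zero_le_one order_refl)
      then show ?thesis
        using \<phi>_bound[of "Z 1"] \<Lambda>0 by (metis mult.assoc mult_left_mono order_trans)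
    qed
    ultimately have \<phi>\<rho>: "norm (\<phi> \<rho>) \<le> b + \<Lambda> * C * h\<^sup>2"
      using norm_triangle_ineq4[of "G 1" "\<phi> (Z 1)"] by (simp add: G_def)
    have "norm (\<rho> - h *\<^sub>R quadratic_residual \<omega> p 0 0) \<le> K * h\<^sup>2"
      using K(2)[rule_format, OF N, of 0] unfolding der2 \<rho>_def h_def .
    then have "norm (\<phi> (\<rho> - h *\<^sub>R quadratic_residual \<omega> p 0 0)) \<le> \<Lambda> * (K * h\<^sup>2)"
      using \<phi>_bound \<Lambda>0 by (meson mult_left_mono order_trans)
    then have "norm (\<phi> \<rho> - h *\<^sub>R c) \<le> \<Lambda> * K * h\<^sup>2"
      by (simp add: \<phi>_diff \<phi>_scaleR \<phi>_quad mult.assoc)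
    then have "norm (h *\<^sub>R c) \<le> b + \<Lambda> * C * h\<^sup>2 + \<Lambda> * K * h\<^sup>2"
      using \<phi>\<rho> norm_triangle_ineq3[of "\<phi> \<rho>" "h *\<^sub>R c"] by linarith
    then have "h * norm c \<le> h * (M * h)"
      using h(1) by (simp add: b_def M_def power2_eq_square algebra_simps)
    then show ?thesis
      using h(1) by (simp add: h_def[symmetric])
  qed
  have "norm c \<le> 0"
  proof (rule ccontr)
    assume "\<not> norm c \<le> 0"
    then have pos: "norm c > 0" by simp
    obtain N :: nat where N: "M / norm c < real N"
      using reals_Archimedean2 by blast
    have "0 \<le> M"
      unfolding M_def using C0 \<Lambda>0 K(1) by (intro add_nonneg_nonneg mult_nonneg_nonneg) auto
    then have "N > 0" using N pos by (cases N) (auto simp: divide_less_0_iff)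
    with main[OF this] N pos show False
      by (simp add: field_simps)
  qed
  then show ?thesis
    using p by (simp add: c_def \<phi>_def)
qed

lemma norm_x_wave_diff: "h \<ge> 0 \<Longrightarrow> norm (x_wave (h *\<^sub>R b) - 1) \<le> (2 * pi * \<bar>fst b\<bar>) * h"
proof -
  assume h: "h \<ge> 0"
  have d: "x_wave differentiable (at x)" for x
    using C_k_3D(1)[OF C_k_x_wave[of 3 1]] by simp
  have "norm (dirderiv b x_wave x) \<le> 2 * pi * \<bar>fst b\<bar>" for x
    by (simp add: dirderiv_x_wave1 norm_mult)
  from Taylor_order1[OF d this h, of 0] show ?thesis
    by simp
qed

text \<open>
  A single component of the residual suffices here: the first one is \<open>\<omega>\<^sub>x / 2\<close> for \<open>v\<^sub>x\<^sub>x = 1\<close>.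
\<close>

lemma sd_order_less_3:
  assumes "fst \<omega> \<noteq> 0" and ord: "sd_has_order \<omega> q"
  shows "q < 3"
proof (rule ccontr)
  assume "\<not> q < 3"
  define \<mu> :: "complex^6" where "\<mu> = vector [1, 0, 0, 0, 0, 0]"
  have pick: "(\<Sum>\<xi>\<in>UNIV. \<mu> $ \<xi> * y $ \<xi>) = y $ 1" for y
    by (simp add: \<mu>_def sum_6)
  have "(\<Sum>\<xi>\<in>UNIV. \<mu> $ \<xi> * quadratic_residual \<omega> 1 0 0 $ \<xi>) = 0"
  proof (rule sd_order_obstruction[OF ord, of 3 0 _ "sd_weight \<omega>"])
    fix N :: nat and y :: "complex^6"
    show "norm (\<Sum>\<xi>\<in>UNIV. \<mu> $ \<xi> * sd_symbol \<omega> N y $ \<xi>) \<le> sd_weight \<omega> * (1 / real N) ^ 0 * norm y"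
      unfolding pick unfolding sd_symbol_nth
      using sd_weight_bound[of "\<lambda>\<zeta> \<xi>'. x_wave (block_point N \<zeta>) * y $ \<xi>'"]
      by (simp add: norm_mult Finite_Cartesian_Product.norm_nth_le)
  qed (use \<open>\<not> q < 3\<close> in auto)
  then show False
    using assms(1) unfolding pick by (simp add: quadratic_residual_def Let_def)
qed

text \<open>
  The row vector \<open>\<mu>\<close> represents, up to a multiple of the mass, the energy pairing with the function that is
  0 on the bottom and 1 on the top of the block.  This pairing is conserved for horizontal transport, so
  \<open>\<mu>\<close> is a left null vector of \<open>\<Sum>\<^sub>\<zeta> L\<^sub>\<zeta>\<close>.  On the mode the phases \<open>x_wave (block_point N \<zeta>)\<close> differ from 1 by
  \<open>O(h)\<close>, which is the gain of one power of \<open>h\<close>.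
\<close>

lemma sd_order_less_2:
  assumes "\<omega>x \<noteq> 0" and ord: "sd_has_order (\<omega>x, 0) q"
  shows "q < 2"
proof (rule ccontr)
  assume "\<not> q < 2"
  define \<omega> where "\<omega> = (\<omega>x, 0 :: real)"
  define \<mu> :: "complex^6" where "\<mu> = vector [-2, -2, 1, 3, 3, 0]"
  define B where "B = 6 * (3 * (sd_weight \<omega> * (2 * pi)))"
  have "\<forall>\<xi>. norm (\<mu> $ \<xi>) \<le> 3"
    unfolding forall_6 by (simp add: \<mu>_def)
  then have \<mu>_bound: "norm (\<mu> $ \<xi>) \<le> 3" for \<xi>
    by blast
  have \<mu>_kernel: "(\<Sum>\<xi>\<in>UNIV. \<mu> $ \<xi> * (\<Sum>\<zeta>\<in>sd_stencil. \<Sum>\<xi>'\<in>UNIV. sd_L \<omega> \<zeta> $ \<xi> $ \<xi>' * y $ \<xi>')) = 0" for y :: "complex^6"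
    unfolding sum_stencil sum_6 sd_L_nth sd_Lx_def sd_Ly_def \<omega>_def \<mu>_def
    by (simp add: algebra_simps)
  have "(\<Sum>\<xi>\<in>UNIV. \<mu> $ \<xi> * quadratic_residual \<omega> 1 0 0 $ \<xi>) = 0"
  proof (rule sd_order_obstruction[OF ord[folded \<omega>_def], of 2 1 _ B])
    fix N :: nat and y :: "complex^6" assume N: "N > 0"
    define h where "h = 1 / real N"
    have h: "h > 0" using N by (simp add: h_def)
    define r where "r \<zeta> \<xi> = (x_wave (block_point N \<zeta>) - 1) * y $ \<xi>" for \<zeta> \<xi>
    have r: "norm (r \<zeta> \<xi>) \<le> 2 * pi * h * norm y" if "\<zeta> \<in> sd_stencil" for \<zeta> \<xi>
    proof -
      have "\<bar>real_of_int (fst \<zeta>)\<bar> \<le> 1"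
        using that by (auto simp: sd_stencil_def)
      then have "(2 * pi * \<bar>real_of_int (fst \<zeta>)\<bar>) * h \<le> 2 * pi * h"
        using h by simp
      then have "norm (x_wave (block_point N \<zeta>) - 1) \<le> 2 * pi * h"
        using norm_x_wave_diff[OF less_imp_le[OF h], of "(real_of_int (fst \<zeta>), real_of_int (snd \<zeta>))"]
        unfolding block_point_def h_def[symmetric] fst_conv by linarith
      then show ?thesis
        unfolding r_def norm_mult
        by (intro mult_mono Finite_Cartesian_Product.norm_nth_le) (use h in auto)
    qed
    have "sd_symbol \<omega> N y $ \<xi> = (\<Sum>\<zeta>\<in>sd_stencil. \<Sum>\<xi>'\<in>UNIV. sd_L \<omega> \<zeta> $ \<xi> $ \<xi>' * y $ \<xi>')
        + (\<Sum>\<zeta>\<in>sd_stencil. \<Sum>\<xi>'\<in>UNIV. sd_L \<omega> \<zeta> $ \<xi> $ \<xi>' * r \<zeta> \<xi>')" for \<xi>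
      by (simp add: sd_symbol_nth r_def algebra_simps sum.distrib[symmetric])
    then have "(\<Sum>\<xi>\<in>UNIV. \<mu> $ \<xi> * sd_symbol \<omega> N y $ \<xi>)
        = (\<Sum>\<xi>\<in>UNIV. \<mu> $ \<xi> * (\<Sum>\<zeta>\<in>sd_stencil. \<Sum>\<xi>'\<in>UNIV. sd_L \<omega> \<zeta> $ \<xi> $ \<xi>' * r \<zeta> \<xi>'))"
      using \<mu>_kernel[of y] by (simp only: distrib_left sum.distrib add_0_left)
    also have "norm \<dots> \<le> (\<Sum>\<xi>\<in>(UNIV :: 6 set). 3 * (sd_weight \<omega> * (2 * pi * h * norm y)))"
      by (rule sum_norm_le) (unfold norm_mult, intro mult_mono \<mu>_bound sd_weight_bound r, auto)
    also have "\<dots> = B * (1 / real N) ^ 1 * norm y"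
      by (simp add: B_def h_def)
    finally show "norm (\<Sum>\<xi>\<in>UNIV. \<mu> $ \<xi> * sd_symbol \<omega> N y $ \<xi>) \<le> B * (1 / real N) ^ 1 * norm y" .
  qed (use \<open>\<not> q < 2\<close> in auto)
  then show False
    using assms(1) by (simp add: quadratic_residual_def Let_def sum_6 \<mu>_def \<omega>_def field_simps)
qed

theorem theorem5:
  fixes \<omega>\<^sub>x \<omega>\<^sub>y :: real
  shows "(\<omega>\<^sub>x > 0 \<and> \<omega>\<^sub>y > 0 \<longrightarrow> sd_optimal_order (\<omega>\<^sub>x, \<omega>\<^sub>y) 2) \<and>
         (\<omega>\<^sub>x > 0 \<and> \<omega>\<^sub>y = 0 \<longrightarrow> sd_optimal_order (\<omega>\<^sub>x, \<omega>\<^sub>y) 1)"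
proof (intro conjI impI)
  assume "\<omega>\<^sub>x > 0 \<and> \<omega>\<^sub>y > 0"
  then show "sd_optimal_order (\<omega>\<^sub>x, \<omega>\<^sub>y) 2"
    unfolding sd_optimal_order_def
    using sd_has_order_2[of "(\<omega>\<^sub>x, \<omega>\<^sub>y)"] sd_order_less_3[of "(\<omega>\<^sub>x, \<omega>\<^sub>y)"] by force
next
  assume "\<omega>\<^sub>x > 0 \<and> \<omega>\<^sub>y = 0"
  then show "sd_optimal_order (\<omega>\<^sub>x, \<omega>\<^sub>y) 1"
    unfolding sd_optimal_order_def
    using sd_has_order_1[of "(\<omega>\<^sub>x, \<omega>\<^sub>y)"] sd_order_less_2[of \<omega>\<^sub>x] by force
qed

end
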